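(* Let $|q|<1$, let $\omega:=\exp(2\pi i/3)$, let $\chi_0(n)$ denote the principal character modulo $3$, and let $\psi(q)=\sum_{n=0}^\infty q^{n(n+1)/2}=\frac{(q^2;q^2)_\infty}{(q;q^2)_\infty}$. Then $$ \begin{aligned} 9\sum_{n=1}^\infty\chi_0(n)\frac{nq^n}{1-q^{2n}} &=\frac{\psi^6(q)}{\psi^2(q^3)}-\frac{\psi^3(q^{1/2})\,\psi^3(-q^{1/2})}{\psi(q^{3/2})\,\psi(-q^{3/2})}\\ &=3(1-\omega^2)\sum_{n=1}^\infty\frac{(1-\omega q^{2n})(q;q)_{n-1}(\omega^2q;q^2)_n(-\omega q)^n}{(1-q^{3n})(\omega q;q)_n(q;q^2)_n}\\ &\quad+3(1-\omega)\sum_{n=1}^\infty\frac{(1-\omega^2q^{2n})(q;q)_{n-1}(\omega q;q^2)_n(-\omega^2q)^n}{(1-q^{3n})(\omega^2q;q)_n(q;q^2)_n}. \end{aligned} $$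
   Context: Notation: $(x;q)_0=1$, $(x;q)_n=\prod_{i=0}^{n-1}(1-xq^i)$, $(x;q)_\infty=\prod_{i\ge 0}(1-xq^i)$ for $|q|<1$. The principal character modulo $3$ is $\chi_0(n)=0$ if $3\mid n$ and $\chi_0(n)=1$ otherwise. $q^{1/2}$ denotes a fixed square root of $q$ and $q^{3/2}=(q^{1/2})^3$ (the expression does not depend on the choice of root). *)

theory Defs
  imports "HOL-Analysis.Analysis"
begin

definition qpoch :: "complex \<Rightarrow> complex \<Rightarrow> nat \<Rightarrow> complex" where
  "qpoch x q n = (\<Prod>i<n. 1 - x * q ^ i)"

text \<open>Only meaningful for \<open>norm q < 1\<close>, where the product converges absolutely.\<close>
definition qpoch_inf :: "complex \<Rightarrow> complex \<Rightarrow> complex" where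
  "qpoch_inf x q = (\<Prod>i. 1 - x * q ^ i)"

definition psi :: "complex \<Rightarrow> complex" where
  "psi q = (\<Sum>n. q ^ (n * (n + 1) div 2))"

text \<open>The principal Dirichlet character modulo 3.\<close>
definition chi0 :: "nat \<Rightarrow> complex" where
  "chi0 n = (if 3 dvd n then 0 else 1)"

definition omega :: complex where
  "omega = exp (2 * of_real pi * \<i> / 3)"

end

theory Submission
  imports Defs
begin

text \<open>Write \<open>h(x) = x / (1 - x)\<^sup>2\<close> (the Koebe function) and let \<open>f\<close> be the sum of
  \<open>2 h(q\<^sup>k) - h(\<omega> q\<^sup>k) - h(\<omega>\<^sup>2 q\<^sup>k)\<close> over odd \<open>k > 0\<close>. Expanding \<open>h\<close> in powers shows that
  the Lambert series is \<open>f / 3\<close>; the theorem identifies \<open>3 f\<close> with the two other expressions.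

  The very well poised sums are the values at \<open>a = \<omega>\<close> and \<open>a = \<omega>\<^sup>2\<close> of one function \<open>F(a)\<close>, a double
  limit of the \<open>q\<close>-Watson sum. A WZ certificate gives
  \<open>F(a) - F(a q) = h(a\<^sup>2 q\<^sup>2) - h(a q)\<close>; iterating towards \<open>a = 0\<close> and comparing with
  \<open>F(1) = 0\<close> evaluates \<open>F\<close> as a Lambert series, and \<open>F(\<omega>) + F(\<omega>\<^sup>2) = f\<close>.

  For the products of \<open>\<psi>\<close>, the Jacobi triple product turns products of two theta series into a
  bilinear form of rank two, which yields a three-term relation between theta functions at
  \<open>x y\<close>, \<open>x / y\<close>, \<open>x\<close> and \<open>y\<close>. Its first order term as \<open>y \<rightarrow> 1\<close> expresses \<open>f\<close> as a theta
  quotient, and its case \<open>x = y = \<omega>\<close> is the identity between the two theta quotients that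
  occur.\<close>

section \<open>Infinite products\<close>

lemma prod_one_minus_tendsto:
  fixes c :: "nat \<Rightarrow> complex"
  assumes "summable (\<lambda>i. norm (c i))"
  shows "(\<lambda>n. \<Prod>i<n. 1 - c i) \<longlonglongrightarrow> (\<Prod>i. 1 - c i)"
proof -
  have "convergent_prod (\<lambda>i. 1 - c i)"
    by (intro abs_convergent_prod_imp_convergent_prod)
       (use assms in \<open>simp add: abs_convergent_prod_conv_summable\<close>)
  from convergent_prod_LIMSEQ[OF this] show ?thesis
    by (subst filterlim_sequentially_Suc[symmetric]) (simp add: lessThan_Suc_atMost)
qed

lemma prod_one_minus_nonzero:
  fixes c :: "nat \<Rightarrow> complex"
  assumes "summable (\<lambda>i. norm (c i))" "\<And>i. c i \<noteq> 1"
  shows "(\<Prod>i. 1 - c i) \<noteq> 0"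
proof (rule prodinf_nonzero)
  show "convergent_prod (\<lambda>i. 1 - c i)"
    by (intro abs_convergent_prod_imp_convergent_prod)
       (use assms in \<open>simp add: abs_convergent_prod_conv_summable\<close>)
qed (use assms(2) in \<open>metis eq_iff_diff_eq_0\<close>)

lemma summable_norm_power_offset:
  fixes q :: complex
  assumes "norm q < 1"
  shows "summable (\<lambda>i. norm (x * q ^ i))"
  using assms by (simp add: norm_mult norm_power summable_mult)

lemma qpoch_tendsto:
  assumes "norm q < 1"
  shows "(\<lambda>n. qpoch x q n) \<longlonglongrightarrow> qpoch_inf x q"
  unfolding qpoch_def qpoch_inf_def
  by (rule prod_one_minus_tendsto[OF summable_norm_power_offset[OF assms]])

lemma norm_mult_power_less_1:
  fixes q x :: complex
  assumes "norm q < 1" "norm x < 1"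
  shows "norm (x * q ^ i) < 1"
  using assms by (smt (verit, best) mult_left_le norm_ge_zero norm_mult norm_power power_le_one)

lemma qpoch_inf_nonzero:
  assumes "norm q < 1" "norm x < 1"
  shows "qpoch_inf x q \<noteq> 0"
  unfolding qpoch_inf_def
  by (rule prod_one_minus_nonzero[OF summable_norm_power_offset[OF assms(1)]])
     (use norm_mult_power_less_1[OF assms] in \<open>metis less_irrefl norm_one\<close>)

lemma qpoch_nonzero:
  assumes "norm q < 1" "norm x < 1"
  shows "qpoch x q n \<noteq> 0"
  unfolding qpoch_def using norm_mult_power_less_1[OF assms]
  by (simp, metis less_irrefl norm_one)

lemma qpoch_0 [simp]: "qpoch x q 0 = 1"
  by (simp add: qpoch_def)

lemma qpoch_Suc: "qpoch x q (Suc n) = qpoch x q n * (1 - x * q ^ n)"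
  by (simp add: qpoch_def)

lemma qpoch_Suc_shift: "qpoch x q (Suc n) = (1 - x) * qpoch (x * q) q n"
  by (simp add: qpoch_def prod.lessThan_Suc_shift mult.assoc del: prod.lessThan_Suc)

lemma qpoch_inf_shift:
  assumes "norm q < 1"
  shows "qpoch_inf x q = (1 - x) * qpoch_inf (x * q) q"
proof (rule LIMSEQ_unique)
  show "(\<lambda>n. qpoch x q (Suc n)) \<longlonglongrightarrow> qpoch_inf x q"
    using qpoch_tendsto[OF assms] by (rule LIMSEQ_Suc)
  show "(\<lambda>n. qpoch x q (Suc n)) \<longlonglongrightarrow> (1 - x) * qpoch_inf (x * q) q"
    unfolding qpoch_Suc_shift by (intro tendsto_intros qpoch_tendsto assms)
qed

text \<open>The constants depend on \<open>R\<close> alone, not on the sequence or the number of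
  factors, so one pair controls every finite \<open>q\<close>-product below. The lower one is the
  limit of the products of \<open>1 - R ^ Suc i\<close>, the upper one the exponential of a
  geometric series.\<close>

lemma prod_bounds:
  fixes R :: real
  assumes "0 \<le> R" "R < 1"
  obtains c C where "c > 0" "C > 0"
    "\<And>(x :: nat \<Rightarrow> complex) n. (\<And>i. norm (x i) \<le> R ^ Suc i) \<Longrightarrow> c \<le> norm (\<Prod>i<n. 1 - x i)"
    "\<And>(x :: nat \<Rightarrow> complex) n. (\<And>i. norm (x i) \<le> R ^ Suc i) \<Longrightarrow> norm (\<Prod>i<n. 1 - x i) \<le> C"
proof -
  define r where "r = complex_of_real R"
  have r: "norm r < 1" using assms by (simp add: r_def)
  have eq: "norm (qpoch r r n) = (\<Prod>i<n. 1 - R ^ Suc i)" for n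
  proof -
    have "qpoch r r n = of_real (\<Prod>i<n. 1 - R ^ Suc i)" by (simp add: qpoch_def r_def)
    moreover have "(\<Prod>i<n. 1 - R ^ Suc i) \<ge> 0"
      using assms by (intro prod_nonneg) (auto simp: power_le_one mult_le_one)
    ultimately show ?thesis by (simp only: norm_of_real abs_of_nonneg)
  qed
  \<comment> \<open>The real partial products decrease to \<open>c\<close>, which therefore lies
    below each of them; it is positive because the infinite product does not vanish.\<close>
  define c where "c = norm (qpoch_inf r r)"
  have "(\<lambda>n. norm (qpoch r r n)) \<longlonglongrightarrow> c"
    unfolding c_def by (intro tendsto_norm qpoch_tendsto r)
  moreover have "decseq (\<lambda>n. norm (qpoch r r n))"
  proof (rule decseq_SucI)
    fix n
    have "0 \<le> 1 - R ^ Suc n" "1 - R ^ Suc n \<le> 1"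
      using assms by (auto simp: power_le_one mult_le_one)
    moreover have "0 \<le> (\<Prod>i<n. 1 - R ^ Suc i)"
      using assms by (intro prod_nonneg) (auto simp: power_le_one mult_le_one)
    ultimately show "norm (qpoch r r (Suc n)) \<le> norm (qpoch r r n)"
      unfolding eq prod.lessThan_Suc by (intro mult_left_le)
  qed
  ultimately have lower: "c \<le> (\<Prod>i<n. 1 - R ^ Suc i)" for n
    using decseq_ge[of "\<lambda>n. norm (qpoch r r n)" c n] by (simp add: eq)
  have cpos: "c > 0"
    using qpoch_inf_nonzero[OF r r] by (simp add: c_def)
  define C where "C = exp (\<Sum>i. R ^ Suc i)"
  show ?thesis
  proof (rule that)
    fix x :: "nat \<Rightarrow> complex" and n
    assume x: "\<And>i. norm (x i) \<le> R ^ Suc i"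
    have le1: "R ^ Suc i \<le> 1" for i using assms by (simp add: mult_le_one power_le_one)
    have "(\<Prod>i<n. 1 - R ^ Suc i) \<le> (\<Prod>i<n. norm (1 - x i))"
    proof (intro prod_mono conjI)
      fix i
      show "0 \<le> 1 - R ^ Suc i" using le1 by simp
      show "1 - R ^ Suc i \<le> norm (1 - x i)"
        using x[of i] norm_triangle_ineq2[of 1 "x i"] by simp
    qed
    with lower[of n] show "c \<le> norm (\<Prod>i<n. 1 - x i)" by (simp add: prod_norm)
    have "norm (\<Prod>i<n. 1 - x i) = (\<Prod>i<n. norm (1 - x i))" by (simp add: prod_norm)
    also have "\<dots> \<le> (\<Prod>i<n. 1 + R ^ Suc i)"
    proof (intro prod_mono conjI)
      fix i
      show "norm (1 - x i) \<le> 1 + R ^ Suc i"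
        using x[of i] norm_triangle_ineq4[of 1 "x i"] by simp
    qed simp
    also have "\<dots> \<le> exp (\<Sum>i<n. R ^ Suc i)"
      using assms by (intro prod_le_exp_sum) auto
    also have "\<dots> \<le> C"
    proof -
      have "summable (\<lambda>i. R ^ Suc i)" using assms by (simp add: summable_mult)
      thus ?thesis unfolding C_def exp_le_cancel_iff using assms by (intro sum_le_suminf) auto
    qed
    finally show "norm (\<Prod>i<n. 1 - x i) \<le> C" .
  qed (use cpos in \<open>auto simp: C_def\<close>)
qed

text \<open>Dominated convergence for series. It carries two limits: \<open>a * q ^ n\<close>
  tending to 0 in the well poised sum, and the number of factors tending to infinity in the triple
  product.\<close>

lemma tannery_sequentially:
  fixes a :: "nat \<Rightarrow> nat \<Rightarrow> complex"
  assumes "\<And>k. (\<lambda>n. a k n) \<longlonglongrightarrow> b k" "\<And>k n. norm (a k n) \<le> M k" "summable M"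
  shows "(\<lambda>n. \<Sum>k. a k n) \<longlonglongrightarrow> (\<Sum>k. b k)" "summable b"
proof -
  have *: "eventually (\<lambda>n. summable (\<lambda>k. norm (a k n))) sequentially \<and>
      summable (\<lambda>n. norm (b n)) \<and> (\<lambda>n. \<Sum>k. a k n) \<longlonglongrightarrow> (\<Sum>k. b k)"
    by (rule tannerys_theorem[where M = M]) (use assms in \<open>auto intro!: always_eventually\<close>)
  show "(\<lambda>n. \<Sum>k. a k n) \<longlonglongrightarrow> (\<Sum>k. b k)" "summable b"
    using * summable_norm_cancel by blast+
qed

section \<open>Telescoping the well poised sum\<close>

lemma qpoch_shift_divide:
  assumes "1 - x \<noteq> 0"
  shows "qpoch (x * q) q n = qpoch x q n * (1 - x * q ^ n) / (1 - x)"
  using qpoch_Suc[of x q n] qpoch_Suc_shift[of x q n] assms by (simp add: field_simps)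

text \<open>The telescoping relation with its denominators cleared, \<open>y\<close> standing for
  \<open>q ^ m\<close>. As \<open>y\<close> is an independent variable here, one polynomial identity
  serves all \<open>m\<close>.\<close>

lemma wz_polynomial:
  fixes a q y :: complex
  shows "(1 - a*q^2*y^2) * (y - a) * (1 - a*q^2*y)^2 * (1 - a^2*q^2*y) * (1 - a^2*q^3*y) * (1 + a*q)
       - (1 - a*q^3*y^2) * (1 - a*q)^2 * y * (1 - a^2*q^3*y^2) * (1 - a^2*q^2) * (1 - a*q*y) * (1 + a*q)
     = (1 - q*y)^2 * (y - a) * (1 - a^2*q^3*y^2) * q * a * (1 - a^3*q^4*y) * (1 - a*q*y)
       - a * (1 - a^3*q^3*y) * (1 - q*y^2) * (1 - q*y) * (1 - a*q^2*y)^2 * (1 - a^2*q^3*y)"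
  by algebra

text \<open>Treating every linear factor as an atom keeps the clearing of denominators apart from
  the expansion in \<open>a\<close>, \<open>q\<close> and \<open>y\<close>.\<close>

lemma wz_clear_denominators:
  fixes d0 d1 d2 d3 d4 e :: complex
  assumes "d0 \<noteq> 0" "d1 \<noteq> 0" "d2 \<noteq> 0" "d3 \<noteq> 0" "d4 \<noteq> 0" "e \<noteq> 0"
    "n1 * d2^2 * d3 * d4 * e - n2 * d1 * e = n3 * d0 * d1 - n4 * d0 * d2^2 * d4"
  shows "n1 / (d0 * d1) - n2 / (d0 * d2^2 * d3 * d4) = n3 / (e * d2^2 * d4 * d3) - n4 / (e * d1 * d3)"
proof -
  have "n1 / (d0 * d1) - n2 / (d0 * d2^2 * d3 * d4) = (n1 * d2^2 * d3 * d4 * e - n2 * d1 * e) / (d0*d1*d2^2*d3*d4*e)"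
    using assms(1-6) by (simp add: divide_simps) (simp add: algebra_simps)
  also have "\<dots> = n3 / (e * d2^2 * d4 * d3) - n4 / (e * d1 * d3)"
    unfolding assms(7) using assms(1-6) by (simp add: divide_simps) (simp add: algebra_simps)
  finally show ?thesis .
qed

lemma wz_rational:
  fixes a q y :: complex
  assumes "1 - q*y \<noteq> 0" "1 - a*q*y \<noteq> 0" "1 - a*q^2*y \<noteq> 0" "1 - a^2*q^2*y \<noteq> 0"
    "1 - a^2*q^3*y \<noteq> 0" "1 + a*q \<noteq> 0"
  shows "(1 - a*q^2*y^2) * (y - a) / ((1 - q*y) * (1 - a*q*y))
       - (1 - a*q^3*y^2) * (1 - a*q)^2 * y * (1 - a^2*q^3*y^2) * (1 - a^2*q^2)
           / ((1 - q*y) * (1 - a*q^2*y)^2 * (1 - a^2*q^2*y) * (1 - a^2*q^3*y))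
     = (1 - q*y) * (y - a) * (1 - a^2*q^3*y^2) * q * a * (1 - a^3*q^4*y)
          / ((1 + a*q) * (1 - a*q^2*y)^2 * (1 - a^2*q^3*y) * (1 - a^2*q^2*y))
      - a * (1 - a^3*q^3*y) * (1 - q*y^2) / ((1 + a*q) * (1 - a*q*y) * (1 - a^2*q^2*y))"
  by (rule wz_clear_denominators) (use assms wz_polynomial[of a q y] in \<open>simp_all add: power2_eq_square mult_ac\<close>)

text \<open>Both sequences start at \<open>m = 0\<close>, which is the summand \<open>n = 1\<close> of the series.\<close>

definition wz_term :: "complex \<Rightarrow> complex \<Rightarrow> nat \<Rightarrow> complex" where
  "wz_term q a m = (1 - a * q ^ (2 * Suc m)) * qpoch q q m * (\<Prod>i<Suc m. q ^ i - a)
      * qpoch (a^2 * q) (q^2) (Suc m) * q ^ Suc m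
    / ((1 - q ^ Suc m) * (1 - a * q ^ Suc m) * qpoch (a * q) q (Suc m)
        * qpoch (a^2 * q) q (Suc m) * qpoch q (q^2) (Suc m))"

text \<open>A rational function of \<open>a\<close>, \<open>q\<close> and \<open>q ^ m\<close> times
  \<open>wz_term\<close>, with the factor \<open>q ^ m - a\<close> cancelled so that zeros of
  \<open>wz_term\<close> do no harm. The product of the \<open>q ^ i - a\<close> is a power of
  \<open>-a\<close> times a Pochhammer symbol of \<open>1 / a\<close>, written so that
  \<open>a = 0\<close> is allowed.\<close>

definition wz_cert :: "complex \<Rightarrow> complex \<Rightarrow> nat \<Rightarrow> complex" where
  "wz_cert q a m = qpoch q q m * (\<Prod>i<m. q ^ i - a) * qpoch (a^2 * q) (q^2) (Suc m)
      * q ^ Suc m * a * (1 - a^3 * q ^ (m + 3))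
    / ((1 + a * q) * (1 - a * q ^ Suc m) * (1 - a^2 * q ^ (m + 2)) * qpoch (a * q) q (Suc m)
        * qpoch (a^2 * q) q (Suc m) * qpoch q (q^2) m)"

lemma norm_mult_power_Suc_less_1:
  fixes q x :: complex
  assumes "norm q < 1" "norm x \<le> 1"
  shows "norm (x * q ^ Suc i) < 1"
proof -
  have "norm (x * q ^ Suc i) \<le> 1 * norm q ^ Suc i"
    unfolding norm_mult norm_power using assms by (intro mult_right_mono) auto
  also have "\<dots> < 1" using assms power_Suc_less_one[of "norm q" i] by (cases "q = 0") auto
  finally show ?thesis .
qed

lemma one_minus_mult_power_nonzero:
  fixes q x :: complex
  assumes "norm q < 1" "norm x \<le> 1"
  shows "1 - x * q ^ Suc i \<noteq> 0"
  using norm_mult_power_Suc_less_1[OF assms, of i] by auto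

text \<open>Each Pochhammer symbol in the four terms differs from one of length \<open>m\<close> at
  the unshifted \<open>a\<close> by a few linear factors. Dividing out what is common leaves
  \<open>wz_rational\<close>.\<close>

lemma wz_pair:
  assumes q: "norm q < 1" and a: "norm a \<le> 1"
  shows "wz_term q a m - wz_term q (a * q) m = wz_cert q a (Suc m) - wz_cert q a m"
proof -
  define y where "y = q ^ m"
  define A where "A = qpoch q q m"
  define P where "P = (\<Prod>i<m. q ^ i - a)"
  define S where "S = qpoch (a^2 * q) (q^2) m"
  define B where "B = qpoch (a * q) q m"
  define C where "C = qpoch (a^2 * q) q m"
  define D where "D = qpoch q (q^2) m"
  have a2: "norm (a^2) \<le> 1" using a by (simp add: norm_power power_le_one)
  have q2: "norm (q^2) < 1" using q by (simp add: norm_power power_less_one_iff)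
  note nz = one_minus_mult_power_nonzero[OF q]
  have n0: "1 - q * y \<noteq> 0" using nz[of 1 m] by (simp add: y_def)
  have n1: "1 - a * q * y \<noteq> 0" using nz[OF a, of m] by (simp add: y_def mult_ac)
  have n2: "1 - a * q^2 * y \<noteq> 0" using nz[OF a, of "Suc m"] by (simp add: y_def mult_ac power2_eq_square)
  have n3: "1 - a^2 * q * y \<noteq> 0" using nz[OF a2, of m] by (simp add: y_def mult_ac)
  have n4: "1 - a^2 * q^2 * y \<noteq> 0" using nz[OF a2, of "Suc m"] by (simp add: y_def mult_ac power2_eq_square)
  have n5: "1 - a^2 * q^3 * y \<noteq> 0"
    using nz[OF a2, of "Suc (Suc m)"] by (simp add: y_def mult_ac power2_eq_square power3_eq_cube)
  have n6: "1 - q * y^2 \<noteq> 0"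
    using nz[of 1 "2*m"] by (simp add: y_def power_mult power2_eq_square power_mult_distrib mult_ac)
  have n7: "1 + a * q \<noteq> 0"
    using nz[of "-a" 0] a by simp
  have n8: "1 - a * q \<noteq> 0" using nz[OF a, of 0] by simp
  have n9: "1 - a^2 * q \<noteq> 0" using nz[OF a2, of 0] by simp
  have n10: "1 - a^2 * q^2 \<noteq> 0" using nz[OF a2, of 1] by (simp add: power2_eq_square)
  have aq: "norm (a * q) < 1" using norm_mult_power_Suc_less_1[OF q a, of 0] by simp
  have a2q: "norm (a^2 * q) < 1" using norm_mult_power_Suc_less_1[OF q a2, of 0] by simp
  have B0: "B \<noteq> 0" unfolding B_def by (rule qpoch_nonzero[OF q aq])
  have C0: "C \<noteq> 0" unfolding C_def by (rule qpoch_nonzero[OF q a2q])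
  have D0: "D \<noteq> 0" unfolding D_def by (rule qpoch_nonzero[OF q2 q])
  have yy: "q ^ Suc m = q * y" "q ^ (2 * Suc m) = q^2 * y^2" "q ^ (m + 3) = q^3 * y" "q ^ (m + 2) = q^2 * y"
    "q ^ (Suc m + 3) = q^4 * y" "q ^ (Suc m + 2) = q^3 * y" "q ^ Suc (Suc m) = q^2 * y" "(q^2) ^ m = y^2"
    "(q^2) ^ Suc m = q^2 * y^2"
    by (simp_all add: y_def power_add power_mult power2_eq_square power_mult_distrib power3_eq_cube
          eval_nat_numeral algebra_simps)
  have S1: "qpoch (a^2 * q) (q^2) (Suc m) = S * (1 - a^2 * q * y^2)"
    by (simp add: qpoch_Suc S_def yy)
  have S2: "qpoch (a^2 * q) (q^2) (Suc (Suc m)) = S * (1 - a^2 * q * y^2) * (1 - a^2 * q^3 * y^2)"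
    unfolding qpoch_Suc S_def yy by (simp add: algebra_simps power2_eq_square power3_eq_cube)
  \<comment> \<open>Replacing \<open>a\<close> by \<open>a * q\<close> multiplies \<open>a^2\<close>
    by \<open>q^2\<close>. This is one shift for a product in base \<open>q^2\<close>, but two for
    the product in base \<open>q\<close> handled in \<open>C3\<close>.\<close>
  have "(a * q)^2 * q = (a^2 * q) * q^2" by (simp add: power2_eq_square mult_ac)
  hence S3: "qpoch ((a * q)^2 * q) (q^2) (Suc m) = S * (1 - a^2 * q * y^2) * (1 - a^2 * q^3 * y^2) / (1 - a^2 * q)"
    by (simp only: qpoch_shift_divide[OF n9, of "q^2"] S1 yy) (simp add: mult_ac power2_eq_square power3_eq_cube)
  have B1: "qpoch (a * q) q (Suc m) = B * (1 - a * q * y)"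
    by (simp add: qpoch_Suc B_def y_def)
  have B2: "qpoch (a * q) q (Suc (Suc m)) = B * (1 - a * q * y) * (1 - a * q^2 * y)"
    by (simp add: qpoch_Suc B_def y_def power2_eq_square mult_ac)
  have B3: "qpoch (a * q * q) q (Suc m) = B * (1 - a * q * y) * (1 - a * q^2 * y) / (1 - a * q)"
    by (simp only: qpoch_shift_divide[OF n8] B1 yy) (simp add: mult_ac power2_eq_square)
  have C1: "qpoch (a^2 * q) q (Suc m) = C * (1 - a^2 * q * y)"
    by (simp add: qpoch_Suc C_def y_def)
  have C2: "qpoch (a^2 * q) q (Suc (Suc m)) = C * (1 - a^2 * q * y) * (1 - a^2 * q^2 * y)"
    by (simp add: qpoch_Suc C_def y_def power2_eq_square mult_ac)
  have C2': "qpoch (a^2 * q * q) q (Suc m) = C * (1 - a^2 * q * y) * (1 - a^2 * q^2 * y) / (1 - a^2 * q)"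
    by (simp only: qpoch_shift_divide[OF n9] C1 yy) (simp add: mult_ac power2_eq_square)
  have n10': "1 - a^2 * q * q \<noteq> 0" using n10 by (simp add: power2_eq_square mult_ac)
  have "(a * q)^2 * q = (a^2 * q * q) * q" by (simp add: power2_eq_square mult_ac)
  hence C3: "qpoch ((a * q)^2 * q) q (Suc m)
      = C * (1 - a^2 * q * y) * (1 - a^2 * q^2 * y) * (1 - a^2 * q^3 * y) / ((1 - a^2 * q) * (1 - a^2 * q^2))"
    by (simp only: qpoch_shift_divide[OF n10'] C2' yy) (simp add: mult_ac power2_eq_square power3_eq_cube)
  have D1: "qpoch q (q^2) (Suc m) = D * (1 - q * y^2)"
    by (simp add: qpoch_Suc D_def yy)
  \<comment> \<open>After the factor for \<open>i = 0\<close> is split off, each remaining factor is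
    \<open>q\<close> times a factor of \<open>P\<close>; the \<open>m\<close> powers of
    \<open>q\<close> make up \<open>y\<close>.\<close>
  have P3: "(\<Prod>i<Suc m. q ^ i - a * q) = (1 - a * q) * y * P"
  proof -
    have "(\<Prod>i<m. q ^ Suc i - a * q) = (\<Prod>i<m. q * (q ^ i - a))"
      by (intro prod.cong) (auto simp: algebra_simps)
    also have "\<dots> = y * P" by (simp add: prod.distrib y_def P_def)
    finally show ?thesis unfolding prod.lessThan_Suc_shift by simp
  qed
  \<comment> \<open>The hypergeometric part shared by the four terms; their cofactors are rational
    in \<open>a\<close>, \<open>q\<close> and \<open>y\<close>.\<close>
  define K where "K = A * P * S * (1 - a^2 * q * y^2) * q * y
      / (B * C * D * (1 - a * q * y) * (1 - a^2 * q * y) * (1 - q * y^2))"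
  have t1: "wz_term q a m = K * ((1 - a*q^2*y^2) * (y - a) / ((1 - q*y) * (1 - a*q*y)))"
    unfolding wz_term_def S1 B1 C1 D1 prod.lessThan_Suc yy K_def
    by (simp add: A_def P_def y_def mult_ac)
  have aq1: "a * q * (q * y) = a * q^2 * y" "a * q * (q^2 * y^2) = a * q^3 * y^2"
    by (simp_all add: power2_eq_square power3_eq_cube)
  have t2: "wz_term q (a * q) m = K * ((1 - a*q^3*y^2) * (1 - a*q)^2 * y * (1 - a^2*q^3*y^2) * (1 - a^2*q^2)
           / ((1 - q*y) * (1 - a*q^2*y)^2 * (1 - a^2*q^2*y) * (1 - a^2*q^3*y)))"
    unfolding wz_term_def S3 B3 C3 D1 P3 yy K_def aq1 A_def[symmetric]
    using n8 n9 n10 by (simp add: power2_eq_square mult_ac)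
  have c1: "wz_cert q a m = K * (a * (1 - a^3*q^3*y) * (1 - q*y^2) / ((1 + a*q) * (1 - a*q*y) * (1 - a^2*q^2*y)))"
    unfolding wz_cert_def S1 B1 C1 yy K_def A_def[symmetric] P_def[symmetric] D_def[symmetric]
    using n6 by (simp add: mult_ac)
  have A1: "qpoch q q (Suc m) = A * (1 - q * y)" by (simp add: qpoch_Suc A_def y_def)
  have c2: "wz_cert q a (Suc m) = K * ((1 - q*y) * (y - a) * (1 - a^2*q^3*y^2) * q * a * (1 - a^3*q^4*y)
          / ((1 + a*q) * (1 - a*q^2*y)^2 * (1 - a^2*q^3*y) * (1 - a^2*q^2*y)))"
    unfolding wz_cert_def S2 B2 C2 D1 A1 yy K_def prod.lessThan_Suc P_def[symmetric] y_def[symmetric]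
    by (simp add: mult_ac power2_eq_square)
  show ?thesis
    unfolding t1 t2 c1 c2 using wz_rational[OF n0 n1 n2 n4 n5 n7]
    by (simp only: right_diff_distrib[symmetric])
qed

section \<open>Uniform bounds and summation of the telescoping relation\<close>

definition koebe :: "complex \<Rightarrow> complex" where
  "koebe x = x / (1 - x)^2"

text \<open>All products and linear factors are bounded above, and those in the denominators also
  away from 0, uniformly for \<open>a\<close> in the closed unit disc; the factor
  \<open>q ^ Suc m\<close> supplies the decay. Uniformity in \<open>a\<close> is what the limit
  along \<open>a * q ^ n\<close> requires.\<close>

lemma wz_term_bound:
  assumes q: "norm q < 1"
  obtains K where "\<And>a m. norm a \<le> 1 \<Longrightarrow> norm (wz_term q a m) \<le> K * norm q ^ m"
    "\<And>a m. norm a \<le> 1 \<Longrightarrow> norm (wz_cert q a m) \<le> K * norm q ^ m"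
proof -
  define R where "R = norm q"
  have R: "0 \<le> R" "R < 1" using q by (auto simp: R_def)
  obtain c C where c: "c > 0" "C > 0" 
    and lo: "\<And>(x :: nat \<Rightarrow> complex) n. (\<And>i. norm (x i) \<le> R ^ Suc i) \<Longrightarrow> c \<le> norm (\<Prod>i<n. 1 - x i)"
    and hi: "\<And>(x :: nat \<Rightarrow> complex) n. (\<And>i. norm (x i) \<le> R ^ Suc i) \<Longrightarrow> norm (\<Prod>i<n. 1 - x i) \<le> C"
    using prod_bounds[OF R] by blast
  have xq: "norm (x * q * q ^ i) \<le> R ^ Suc i" if "norm x \<le> 1" for x i
    using mult_right_mono[OF that, of "R ^ Suc i"] R by (simp add: norm_mult norm_power R_def mult_ac)
  have pw: "R ^ (2 * i) * R \<le> R ^ Suc i" for i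
    using power_decreasing[of "Suc i" "Suc (2*i)" R] R by (simp add: mult_ac)
  have xq2: "norm (x * q * (q^2) ^ i) \<le> R ^ Suc i" if "norm x \<le> 1" for x i
  proof -
    have "norm (x * q * (q^2) ^ i) = norm x * (R ^ (2 * i) * R)"
      by (simp add: norm_mult norm_power R_def power_mult)
    also have "\<dots> \<le> 1 * R ^ Suc i" using that pw R by (intro mult_mono) auto
    finally show ?thesis by simp
  qed
  have lo1: "c \<le> norm (qpoch (x * q) q n)" "norm (qpoch (x * q) q n) \<le> C" if "norm x \<le> 1" for x n
    unfolding qpoch_def using lo[of "\<lambda>i. x * q * q ^ i"] hi[of "\<lambda>i. x * q * q ^ i"] xq[OF that] by auto
  have lo2: "c \<le> norm (qpoch (x * q) (q^2) n)" "norm (qpoch (x * q) (q^2) n) \<le> C" if "norm x \<le> 1" for x n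
    unfolding qpoch_def using lo[of "\<lambda>i. x * q * (q^2) ^ i"] hi[of "\<lambda>i. x * q * (q^2) ^ i"] xq2[OF that] by auto
  \<comment> \<open>The factor for \<open>i = 0\<close> is \<open>1 - a\<close>, of norm at most 2,
    and the others have norm at most \<open>1 + R ^ i\<close>. The summand 1 in the bound covers the
    empty product.\<close>
  have P: "norm (\<Prod>i<m. q ^ i - a) \<le> 2 * C + 1" if a: "norm a \<le> 1" for a m
  proof (cases m)
    case (Suc k)
    have "norm (\<Prod>i<m. q ^ i - a) = norm (1 - a) * (\<Prod>i<k. norm (q ^ Suc i - a))"
      unfolding Suc prod.lessThan_Suc_shift by (simp add: norm_mult prod_norm)
    also have "\<dots> \<le> 2 * (\<Prod>i<k. norm (1 - (- (complex_of_real R ^ Suc i))))"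
    proof (intro mult_mono prod_mono conjI)
      show "norm (1 - a) \<le> 2" using norm_triangle_ineq4[of 1 a] a by simp
      fix i
      have "norm (q ^ Suc i - a) \<le> R ^ Suc i + 1"
        using norm_triangle_ineq4[of "q ^ Suc i" a] a unfolding norm_power R_def by linarith
      also have "\<dots> = norm (complex_of_real (R ^ Suc i + 1))"
        using R by (subst norm_of_real) simp
      also have "\<dots> = norm (1 - (- (complex_of_real R ^ Suc i)))" by (simp add: add_ac)
      finally show "norm (q ^ Suc i - a) \<le> norm (1 - (- (complex_of_real R ^ Suc i)))" .
    qed (auto intro: prod_nonneg)
    also have "(\<Prod>i<k. norm (1 - (- (complex_of_real R ^ Suc i)))) \<le> C"
      unfolding prod_norm by (rule hi) (use R in \<open>simp add: norm_mult norm_power\<close>)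
    finally show ?thesis by simp
  qed (use c in auto)
  have fac: "1 - R \<le> norm (1 - x * q ^ Suc i)" "norm (1 - x * q ^ i) \<le> 2" if "norm x \<le> 1" for x i
  proof -
    have "norm (x * q ^ Suc i) \<le> 1 * R ^ Suc 0"
      unfolding norm_mult[of x] norm_power R_def[symmetric] using that R
      by (intro mult_mono power_decreasing) auto
    thus "1 - R \<le> norm (1 - x * q ^ Suc i)"
      using norm_triangle_ineq2[of 1 "x * q ^ Suc i"] by simp
    have "norm (x * q ^ i) \<le> 1 * 1"
      unfolding norm_mult[of x] norm_power R_def[symmetric] using that R
      by (intro mult_mono power_le_one) auto
    thus "norm (1 - x * q ^ i) \<le> 2"
      using norm_triangle_ineq4[of 1 "x * q ^ i"] by simp
  qed
  have pos: "0 < 1 - R" using R by simp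
  have frac: "norm (x / y) \<le> X / d * R ^ m" if "norm x \<le> X * R ^ m" "d \<le> norm y" "0 < d" for x y :: complex and X d m
  proof -
    have "norm x / norm y \<le> (X * R ^ m) / d" using that order_trans[OF norm_ge_zero that(1)] by (intro frac_le) auto
    thus ?thesis by (simp add: norm_divide)
  qed
  have Rm: "norm (q ^ Suc m) \<le> R ^ m" for m
    using R by (simp add: norm_mult norm_power R_def mult_left_le_one_le)
  define K1 where "K1 = 2 * C * (2 * C + 1) * C / ((1 - R) * (1 - R) * c * c * c)"
  define K2 where "K2 = C * (2 * C + 1) * C * 2 / ((1 - R) * (1 - R) * (1 - R) * c * c * c)"
  show ?thesis
  proof (rule that)
    fix a :: complex and m assume a: "norm a \<le> 1"
    have a2: "norm (a^2) \<le> 1" "norm (a^3) \<le> 1" using a by (auto simp: norm_power power_le_one)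
    have q1: "qpoch q q m = qpoch (1 * q) q m" "qpoch q (q^2) m = qpoch (1 * q) (q^2) m" for m by simp_all
    have m1: "norm (1::complex) \<le> 1" "norm (-a) \<le> 1" using a by simp_all
    have "norm (wz_term q a m) \<le> K1 * R ^ m"
      unfolding wz_term_def K1_def
    proof (rule frac)
      show "norm ((1 - a * q ^ (2 * Suc m)) * qpoch q q m * (\<Prod>i<Suc m. q ^ i - a)
          * qpoch (a^2 * q) (q^2) (Suc m) * q ^ Suc m) \<le> 2 * C * (2 * C + 1) * C * R ^ m"
        unfolding norm_mult[of _ "q ^ Suc m"] norm_mult[of _ "qpoch _ _ _"] norm_mult[of _ "prod _ _"] q1
        by (intro mult_mono Rm lo1(2) lo2(2) P fac(2) a a2 m1 mult_nonneg_nonneg norm_ge_zero) (use c R in auto)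
      show "(1 - R) * (1 - R) * c * c * c \<le> norm ((1 - q ^ Suc m) * (1 - a * q ^ Suc m) * qpoch (a * q) q (Suc m)
        * qpoch (a^2 * q) q (Suc m) * qpoch q (q^2) (Suc m))"
        unfolding norm_mult[of _ "_ - _"] norm_mult[of _ "qpoch _ _ _"] q1
        by (intro mult_mono lo1(1) lo2(1) fac(1)[OF m1(1), simplified mult_1] fac(1) a a2 m1 mult_nonneg_nonneg norm_ge_zero)
           (use c pos in auto)
    qed (use c pos in auto)
    also have "\<dots> \<le> max K1 K2 * R ^ m" using R by (intro mult_right_mono) auto
    finally show "norm (wz_term q a m) \<le> max K1 K2 * norm q ^ m" by (simp add: R_def)
    have "norm (wz_cert q a m) \<le> K2 * R ^ m"
      unfolding wz_cert_def K2_def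
    proof (rule frac)
      have "norm (qpoch q q m * (\<Prod>i<m. q ^ i - a) * qpoch (a^2 * q) (q^2) (Suc m)
          * q ^ Suc m * a * (1 - a^3 * q ^ (m + 3))) \<le> C * (2 * C + 1) * C * R ^ m * 1 * 2"
        unfolding norm_mult[of _ "q ^ Suc m"] norm_mult[of _ "_ - _"] norm_mult[of _ a] norm_mult[of _ "qpoch _ _ _"] norm_mult[of _ "prod _ _"] q1
        by (intro mult_mono Rm lo1(2) lo2(2) P fac(2) a a2 m1 mult_nonneg_nonneg norm_ge_zero) (use c R in auto)
      thus "norm (qpoch q q m * (\<Prod>i<m. q ^ i - a) * qpoch (a^2 * q) (q^2) (Suc m)
          * q ^ Suc m * a * (1 - a^3 * q ^ (m + 3))) \<le> C * (2 * C + 1) * C * 2 * R ^ m" by (simp add: algebra_simps)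
      have f: "1 - R \<le> norm (1 + a * q)" using fac(1)[OF m1(2), of 0] by simp
      have g: "1 - R \<le> norm (1 - a^2 * q ^ (m + 2))" using fac(1)[OF a2(1), of "Suc m"] by simp
      show "(1 - R) * (1 - R) * (1 - R) * c * c * c \<le> norm ((1 + a * q) * (1 - a * q ^ Suc m) * (1 - a^2 * q ^ (m + 2)) * qpoch (a * q) q (Suc m)
        * qpoch (a^2 * q) q (Suc m) * qpoch q (q^2) m)"
        unfolding norm_mult[of _ "_ - _"] norm_mult[of _ "qpoch _ _ _"] q1
        by (intro mult_mono f g lo1(1) lo2(1) fac(1) a a2 m1 mult_nonneg_nonneg norm_ge_zero)
           (use c pos in auto)
    qed (use c pos in auto)
    also have "\<dots> \<le> max K1 K2 * R ^ m" using R by (intro mult_right_mono) auto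
    finally show "norm (wz_cert q a m) \<le> max K1 K2 * norm q ^ m" by (simp add: R_def)
  qed
qed

lemma koebe_summable:
  assumes q: "norm q < 1" and x: "norm x < 1"
  shows "summable (\<lambda>k. norm (koebe (x * q ^ k)))"
proof (rule summable_comparison_test')
  show "summable (\<lambda>k. norm q ^ k / (1 - norm x)^2)"
    using q by (intro summable_divide summable_geometric) auto
  fix k :: nat
  have le: "norm (x * q ^ k) \<le> norm q ^ k"
    unfolding norm_mult norm_power using x by (intro mult_left_le_one_le) auto
  have "norm (x * q ^ k) \<le> norm x"
    unfolding norm_mult norm_power using q by (intro mult_right_le_one_le) (auto simp: power_le_one)
  hence "1 - norm x \<le> norm (1 - x * q ^ k)"
    using norm_triangle_ineq2[of 1 "x * q ^ k"] by simp
  hence "norm (koebe (x * q ^ k)) \<le> norm q ^ k / (1 - norm x)^2"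
    unfolding koebe_def norm_divide norm_power[of "_ - _"] using le x
    by (intro frac_le power_mono) auto
  thus "norm (norm (koebe (x * q ^ k))) \<le> norm q ^ k / (1 - norm x)^2" by simp
qed

lemma koebe_summable_Suc:
  assumes q: "norm q < 1" and x: "norm x \<le> 1"
  shows "summable (\<lambda>k. norm (koebe (x * q ^ Suc k)))"
proof -
  have "norm (x * q) < 1" using norm_mult_power_Suc_less_1[OF q x, of 0] by simp
  from koebe_summable[OF q this] show ?thesis by (simp add: mult_ac)
qed

lemma wz_term_summable:
  assumes "norm q < 1" "norm a \<le> 1"
  shows "summable (wz_term q a)"
proof -
  obtain K where K: "\<And>a m. norm a \<le> 1 \<Longrightarrow> norm (wz_term q a m) \<le> K * norm q ^ m"
    using wz_term_bound[OF assms(1)] by metis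
  show ?thesis
    by (rule summable_comparison_test'[OF _ K[OF assms(2)]])
       (use assms in \<open>intro summable_mult summable_geometric, auto\<close>)
qed

text \<open>The boundary term of the telescoping. With \<open>u = a * q\<close> it is the partial
  fraction identity u (1 + u + u^2) / (1 - u^2)^2 = u / (1 - u)^2 - u^2 / (1 - u^2)^2.\<close>

lemma wz_cert_0:
  assumes "norm q < 1" "norm a \<le> 1"
  shows "wz_cert q a 0 = koebe (a * q) - koebe (a^2 * q^2)"
proof -
  have a2: "norm (a^2) \<le> 1" "norm (-a) \<le> 1" using assms by (auto simp: norm_power power_le_one)
  have n: "1 - a * q \<noteq> 0" "1 - a^2 * q \<noteq> 0" "1 + a * q \<noteq> 0"
    using one_minus_mult_power_nonzero[OF assms, of 0] one_minus_mult_power_nonzero[OF assms(1) a2(1), of 0]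
      one_minus_mult_power_nonzero[OF assms(1) a2(2), of 0] by auto
  have f: "1 - a^2 * q^2 = (1 - a * q) * (1 + a * q)" "1 - a^3 * q^3 = (1 - a * q) * (1 + a * q + (a * q)^2)"
    by (simp_all add: algebra_simps power2_eq_square power3_eq_cube)
  have "wz_cert q a 0 = (1 - a^2 * q) * q * a * (1 - a^3 * q^3) / ((1 + a * q) * (1 - a * q) * (1 - a^2 * q^2) * (1 - a * q) * (1 - a^2 * q))"
    by (simp add: wz_cert_def qpoch_Suc power2_eq_square)
  also have "\<dots> = a * q * (1 + a * q + (a * q)^2) / ((1 - a * q)^2 * (1 + a * q)^2)"
    unfolding f power2_eq_square[of "1 - a * q"] power2_eq_square[of "1 + a * q"] using n by (simp add: divide_simps)
  also have "\<dots> = a * q / (1 - a * q)^2 - a^2 * q^2 / ((1 - a * q)^2 * (1 + a * q)^2)"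
    using n by (simp add: divide_simps) (simp add: algebra_simps power2_eq_square)
  also have "\<dots> = koebe (a * q) - koebe (a^2 * q^2)"
    unfolding koebe_def f power_mult_distrib ..
  finally show ?thesis .
qed

text \<open>Summing \<open>wz_pair\<close> over \<open>m\<close> leaves minus the initial value of
  the certificate, since the certificate tends to 0.\<close>

lemma wz_sum_step:
  assumes q: "norm q < 1" and a: "norm a \<le> 1"
  shows "(\<Sum>m. wz_term q a m) - (\<Sum>m. wz_term q (a * q) m) = koebe (a^2 * q^2) - koebe (a * q)"
proof -
  obtain K where K: "\<And>a m. norm a \<le> 1 \<Longrightarrow> norm (wz_cert q a m) \<le> K * norm q ^ m"
    using wz_term_bound[OF q] by metis
  have "(\<lambda>m. K * norm q ^ m) \<longlonglongrightarrow> K * 0"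
    using q by (intro tendsto_intros LIMSEQ_power_zero) auto
  hence lim: "wz_cert q a \<longlonglongrightarrow> 0"
    using K[OF a] by (intro Lim_null_comparison[of "wz_cert q a"]) auto
  have aq: "norm (a * q) \<le> 1" using norm_mult_power_Suc_less_1[OF q a, of 0] by simp
  have "(\<lambda>m. wz_term q a m - wz_term q (a * q) m) sums (0 - wz_cert q a 0)"
    unfolding wz_pair[OF q a] by (rule telescope_sums[OF lim])
  moreover have "(\<lambda>m. wz_term q a m - wz_term q (a * q) m) sums
      ((\<Sum>m. wz_term q a m) - (\<Sum>m. wz_term q (a * q) m))"
    by (intro sums_diff summable_sums wz_term_summable q a aq)
  ultimately show ?thesis
    using sums_unique2 wz_cert_0[OF q a] by fastforce
qed

text \<open>Iterating the step along \<open>a\<close>, \<open>a * q\<close>, \<open>a * q^2\<close>,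
  ... accumulates the two Koebe series. The one in \<open>a^2\<close> runs in base
  \<open>q^2\<close> because \<open>a\<close> is squared.\<close>

lemma wz_sum:
  assumes q: "norm q < 1" and a: "norm a \<le> 1"
  shows "(\<Sum>m. wz_term q a m) = (\<Sum>m. wz_term q 0 m)
    + (\<Sum>k. koebe (a^2 * (q^2) ^ Suc k)) - (\<Sum>k. koebe (a * q ^ Suc k))"
proof -
  have an: "norm (a * q ^ n) \<le> 1" for n
    using a q by (simp add: norm_mult norm_power mult_le_one power_le_one)
  have fin: "(\<Sum>m. wz_term q a m) - (\<Sum>m. wz_term q (a * q ^ n) m)
      = (\<Sum>k<n. koebe (a^2 * (q^2) ^ Suc k)) - (\<Sum>k<n. koebe (a * q ^ Suc k))" for n
  proof (induction n)
    case (Suc n)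
    have e: "(a * q ^ n)^2 * q^2 = a^2 * (q^2) ^ Suc n" "a * q ^ n * q = a * q ^ Suc n"
      by (simp_all add: power_mult_distrib mult_ac flip: power_mult)
    from wz_sum_step[OF q an[of n]] have "(\<Sum>m. wz_term q (a * q ^ n) m) - (\<Sum>m. wz_term q (a * q ^ Suc n) m)
        = koebe (a^2 * (q^2) ^ Suc n) - koebe (a * q ^ Suc n)"
      unfolding e .
    with Suc show ?case by (simp add: algebra_simps del: power_Suc)
  qed simp
  obtain K where K: "\<And>a m. norm a \<le> 1 \<Longrightarrow> norm (wz_term q a m) \<le> K * norm q ^ m"
    using wz_term_bound[OF q] by metis
  have lim0: "(\<lambda>n. a * q ^ n) \<longlonglongrightarrow> 0"
    using tendsto_mult[OF tendsto_const[of a] LIMSEQ_power_zero[OF q]] by simp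
  have tend: "(\<lambda>n. wz_term q (a * q ^ n) m) \<longlonglongrightarrow> wz_term q 0 m" for m
  proof -
    have n: "norm (q^2) < 1" "1 - q ^ Suc m \<noteq> 0"
      using q one_minus_mult_power_nonzero[OF q, of 1 m] by (auto simp: norm_power power_less_one_iff)
    have *: "(\<Prod>i<Suc m. 1 - q * (q^2) ^ i) \<noteq> 0"
      using qpoch_nonzero[OF n(1) q] unfolding qpoch_def .
    show ?thesis
      unfolding wz_term_def qpoch_def
      by (intro tendsto_divide tendsto_mult tendsto_diff tendsto_power tendsto_prod tendsto_const lim0)
         (use n * in simp)
  qed
  have L1: "(\<lambda>n. \<Sum>m. wz_term q (a * q ^ n) m) \<longlonglongrightarrow> (\<Sum>m. wz_term q 0 m)"
    \<comment> \<open>The dominating series is the same for all \<open>n\<close>, as every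
      \<open>a * q ^ n\<close> stays in the unit disc.\<close>
    by (rule tannery_sequentially(1)[OF tend, where M = "\<lambda>m. K * norm q ^ m"])
       (use K an q in \<open>auto intro!: summable_mult summable_geometric\<close>)
  have a2: "norm (a^2) \<le> 1" "norm (q^2) < 1" using a q by (auto simp: norm_power power_le_one power_less_one_iff)
  have L2: "(\<lambda>n. (\<Sum>k<n. koebe (a^2 * (q^2) ^ Suc k)) - (\<Sum>k<n. koebe (a * q ^ Suc k)))
      \<longlonglongrightarrow> (\<Sum>k. koebe (a^2 * (q^2) ^ Suc k)) - (\<Sum>k. koebe (a * q ^ Suc k))"
    by (intro tendsto_diff summable_LIMSEQ summable_norm_cancel[OF koebe_summable_Suc] a a2 q)
  have "(\<lambda>n. (\<Sum>m. wz_term q a m) - (\<Sum>m. wz_term q (a * q ^ n) m)) 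
      \<longlonglongrightarrow> (\<Sum>m. wz_term q a m) - (\<Sum>m. wz_term q 0 m)"
    by (intro tendsto_intros L1)
  from LIMSEQ_unique[OF this[unfolded fin] L2] show ?thesis by (simp add: algebra_simps del: power_Suc)
qed

text \<open>The point \<open>a = 1\<close>, where every term vanishes, determines the unknown value at \<open>a = 0\<close>.\<close>

lemma wz_sum_eval:
  assumes q: "norm q < 1" and a: "norm a \<le> 1"
  shows "(\<Sum>m. wz_term q a m) = (\<Sum>k. koebe (a^2 * (q^2) ^ Suc k)) - (\<Sum>k. koebe (a * q ^ Suc k))
    - (\<Sum>k. koebe ((q^2) ^ Suc k)) + (\<Sum>k. koebe (q ^ Suc k))"
proof -
  have "wz_term q 1 m = 0" for m
    unfolding wz_term_def prod.lessThan_Suc_shift by simp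
  with wz_sum[OF q, of 1] wz_sum[OF q a] show ?thesis by (simp add: algebra_simps del: power_Suc)
qed

section \<open>The triple product and products of theta series\<close>

text \<open>The Gaussian binomial coefficient. For \<open>k > m\<close> truncated subtraction yields
  a value other than the customary 0, so sums over it are cut off explicitly.\<close>

definition qbinom :: "complex \<Rightarrow> nat \<Rightarrow> nat \<Rightarrow> complex" where
  "qbinom p m k = qpoch p p m / (qpoch p p k * qpoch p p (m - k))"

text \<open>A \<open>q\<close>-Pascal rule: with \<open>l = m - Suc k\<close>, the factor
  \<open>1 - p ^ Suc m\<close> of the numerator splits into \<open>1 - p ^ Suc l\<close> and
  \<open>p ^ Suc l * (1 - p ^ Suc k)\<close>, and each piece cancels one denominator factor.\<close>

lemma qbinom_rec:
  assumes p: "norm p < 1" and k: "k < m"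
  shows "qbinom p (Suc m) (Suc k) = qbinom p m (Suc k) + p ^ (m - k) * qbinom p m k"
proof -
  define l where "l = m - Suc k"
  have m: "m - k = Suc l" "m = Suc (k + l)" "m - Suc k = l" "Suc m - Suc k = Suc l" using k by (auto simp: l_def)
  have nz: "qpoch p p n \<noteq> 0" for n using qpoch_nonzero[OF p p] .
  have nz1: "1 - p * p ^ n \<noteq> 0" for n
    using norm_mult_power_less_1[OF p p, of n] by auto
  have e: "1 - p * p ^ m = (1 - p * p ^ l) + p * p ^ l * (1 - p * p ^ k)"
    unfolding m(2) by (simp add: algebra_simps power_add)
  have "qbinom p (Suc m) (Suc k) = qpoch p p m * (1 - p * p ^ m)
      / (qpoch p p k * (1 - p * p ^ k) * (qpoch p p l * (1 - p * p ^ l)))"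
    unfolding qbinom_def m(4) by (simp add: qpoch_Suc)
  also have "\<dots> = qpoch p p m / (qpoch p p k * (1 - p * p ^ k) * qpoch p p l)
      + p * p ^ l * (qpoch p p m / (qpoch p p k * (qpoch p p l * (1 - p * p ^ l))))"
    unfolding e using nz[of k] nz[of l] nz1[of k] nz1[of l] by (simp add: divide_simps) (simp add: algebra_simps)
  also have "\<dots> = qbinom p m (Suc k) + p ^ (m - k) * qbinom p m k"
    unfolding qbinom_def m(1,3) by (simp add: qpoch_Suc mult_ac)
  finally show ?thesis .
qed

lemma qbinom_0 [simp]: "norm p < 1 \<Longrightarrow> qbinom p m 0 = 1"
  using qpoch_nonzero[of p p m] by (simp add: qbinom_def)

lemma qbinom_self [simp]: "norm p < 1 \<Longrightarrow> qbinom p m m = 1"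
  using qpoch_nonzero[of p p m] by (simp add: qbinom_def)

lemma triangle_Suc: "Suc k * (Suc k - 1) div 2 = k * (k - 1) div 2 + k"
proof -
  have "Suc k * (Suc k - 1) = k * (k - 1) + 2 * k" by (cases k) auto
  thus ?thesis by simp
qed

text \<open>Induction on the number of factors by the \<open>q\<close>-Pascal rule. The homogeneous
  form in \<open>x\<close> and \<open>y\<close> allows \<open>y\<close> to be a power of
  \<open>q\<close> in the finite triple product.\<close>

theorem q_binomial:
  assumes p: "norm p < 1"
  shows "(\<Prod>i<m. y + x * p ^ i) = (\<Sum>k\<le>m. qbinom p m k * p ^ (k * (k - 1) div 2) * x ^ k * y ^ (m - k))"
proof (induction m)
  case (Suc m)
  let ?t = "\<lambda>k. k * (k - 1) div 2"
  define f where "f k = qbinom p m k * p ^ ?t k * x ^ k * y ^ (m - k)" for k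
  have "(\<Prod>i<Suc m. y + x * p ^ i) = (\<Sum>k\<le>m. f k * y) + (\<Sum>k\<le>m. f k * (x * p ^ m))"
    using Suc by (simp add: f_def[abs_def] sum_distrib_right distrib_left)
  also have "(\<Sum>k\<le>m. f k * y) = y ^ Suc m + (\<Sum>k<m. f (Suc k) * y)"
    unfolding lessThan_Suc_atMost[symmetric] sum.lessThan_Suc_shift using p by (simp add: f_def)
  also have "(\<Sum>k\<le>m. f k * (x * p ^ m)) = (\<Sum>k<m. f k * (x * p ^ m)) + p ^ ?t m * x ^ m * (x * p ^ m)"
    unfolding lessThan_Suc_atMost[symmetric] using p by (simp add: f_def)
  also have "y ^ Suc m + (\<Sum>k<m. f (Suc k) * y) + ((\<Sum>k<m. f k * (x * p ^ m)) + p ^ ?t m * x ^ m * (x * p ^ m))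
      = y ^ Suc m + (\<Sum>k<m. f (Suc k) * y + f k * (x * p ^ m)) + p ^ ?t (Suc m) * x ^ Suc m"
    unfolding triangle_Suc power_add by (simp add: sum.distrib algebra_simps)
  also have "(\<Sum>k<m. f (Suc k) * y + f k * (x * p ^ m))
      = (\<Sum>k<m. qbinom p (Suc m) (Suc k) * p ^ ?t (Suc k) * x ^ Suc k * y ^ (Suc m - Suc k))"
  proof (rule sum.cong[OF refl])
    fix k assume "k \<in> {..<m}"
    hence k: "k < m" by simp
    \<comment> \<open>Of \<open>p ^ m\<close>, the part \<open>p ^ k\<close> raises the triangular
      exponent from \<open>k\<close> to \<open>Suc k\<close>, and \<open>p ^ (m - k)\<close> is the
      weight in the Pascal rule.\<close>
    have e: "p ^ m = p ^ k * p ^ (m - k)" "y ^ (m - Suc k) * y = y ^ (m - k)"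
      using k by (simp_all add: power_add[symmetric] Suc_diff_Suc flip: power_Suc2)
    show "f (Suc k) * y + f k * (x * p ^ m)
        = qbinom p (Suc m) (Suc k) * p ^ ?t (Suc k) * x ^ Suc k * y ^ (Suc m - Suc k)"
      unfolding f_def qbinom_rec[OF p k] triangle_Suc power_add e(1) diff_Suc_Suc
      by (simp add: algebra_simps flip: e(2))
  qed
  also have "y ^ Suc m + (\<Sum>k<m. qbinom p (Suc m) (Suc k) * p ^ ?t (Suc k) * x ^ Suc k * y ^ (Suc m - Suc k))
        + p ^ ?t (Suc m) * x ^ Suc m
      = (\<Sum>k\<le>Suc m. qbinom p (Suc m) k * p ^ ?t k * x ^ k * y ^ (Suc m - k))"
    unfolding lessThan_Suc_atMost[symmetric] sum.lessThan_Suc_shift[of _ "Suc m"]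
    using p by (simp add: sum.lessThan_Suc)
  finally show ?case .
qed (use p in simp)

lemma prod_lessThan_add:
  fixes f :: "nat \<Rightarrow> complex"
  shows "(\<Prod>i<m+n. f i) = (\<Prod>i<m. f i) * (\<Prod>i<n. f (m + i))"
  by (induction n) (simp_all add: mult_ac)

lemma sum_lessThan_add:
  fixes f :: "nat \<Rightarrow> complex"
  shows "(\<Sum>i<m+n. f i) = (\<Sum>i<m. f i) + (\<Sum>i<n. f (m + i))"
  by (induction n) (simp_all add: add_ac)

lemma prod_mult_power_lessThan:
  fixes q z :: complex
  shows "(\<Prod>i<n. q * z * (q^2) ^ i) = q ^ (n * n) * z ^ n"
  by (induction n) (simp_all add: power_add power_mult power2_eq_square power_mult_distrib mult_ac)

text \<open>The \<open>q\<close>-binomial theorem in base \<open>q^2\<close> with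
  \<open>2 * N\<close> factors. The upper half of the factors gives the product in
  \<open>q * z\<close>, the lower half, read backwards, the one in \<open>q / z\<close>; centring
  the summation index at \<open>N\<close> produces the square exponents.\<close>

lemma finite_triple_product:
  fixes q z :: complex
  assumes q: "norm q < 1" "q \<noteq> 0" and z: "z \<noteq> 0"
  shows "qpoch (- (q * z)) (q^2) N * qpoch (- (q / z)) (q^2) N
    = (\<Sum>j<Suc N. qbinom (q^2) (N + N) (N + j) * (q ^ (j * j) * z ^ j))
     + (\<Sum>j<N. qbinom (q^2) (N + N) (N - Suc j) * (q ^ (Suc j * Suc j) / z ^ Suc j))"
proof -
  have p: "norm (q^2) < 1" using q by (simp add: norm_power power_less_one_iff)
  define f where "f k = qbinom (q^2) (N+N) k * (q^2) ^ (k * (k - 1) div 2) * (q * z) ^ k * (q ^ (2*N)) ^ (N + N - k)" for k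
  \<comment> \<open>The monomials pulled out of the two halves: \<open>q ^ (N * N) * z ^ N\<close>
    from the lower one and \<open>q ^ (2*N*N)\<close> from the upper one.\<close>
  define c where "c = q ^ (3*N*N) * z ^ N"
  have c0: "c \<noteq> 0" using q z by (simp add: c_def)
  have qk: "(q^2) ^ (k * (k - 1) div 2) * (q * z) ^ k * (q ^ (2*N)) ^ l = q ^ (k * k + 2*N*l) * z ^ k" for k l
  proof -
    have "2 * (k * (k - 1) div 2) + k = k * k" by (cases k) (auto simp: algebra_simps)
    hence e: "(q^2) ^ (k * (k - 1) div 2) * q ^ k = q ^ (k * k)" by (metis power_add power_mult)
    have "(q^2) ^ (k * (k - 1) div 2) * (q * z) ^ k * (q ^ (2*N)) ^ l
        = ((q^2) ^ (k * (k - 1) div 2) * q ^ k) * q ^ (2*N*l) * z ^ k"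
      unfolding power_mult_distrib power_mult[of q "2*N"] by (simp only: mult_ac)
    thus ?thesis unfolding e power_add .
  qed
  have lhs: "(\<Prod>i<N+N. q ^ (2*N) + q * z * (q^2) ^ i)
      = c * (qpoch (- (q * z)) (q^2) N * qpoch (- (q / z)) (q^2) N)"
  proof -
    have "(\<Prod>i<N. q ^ (2*N) + q * z * (q^2) ^ i) = (\<Prod>i<N. q ^ (2*N) + q * z * (q^2) ^ (N - Suc i))"
      by (rule prod.nat_diff_reindex[symmetric])
    also have "\<dots> = (\<Prod>i<N. (q * z * (q^2) ^ (N - Suc i)) * (1 - (- (q / z)) * (q^2) ^ i))"
    proof (rule prod.cong[OF refl])
      fix i assume "i \<in> {..<N}"
      hence "N = Suc (N - Suc i + i)" by simp
      hence "q ^ (2*N) = q^2 * ((q^2) ^ (N - Suc i) * (q^2) ^ i)" by (metis power_Suc power_add power_mult)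
      thus "q ^ (2*N) + q * z * (q^2) ^ (N - Suc i) = (q * z * (q^2) ^ (N - Suc i)) * (1 - (- (q / z)) * (q^2) ^ i)"
        using z by (simp add: field_simps power2_eq_square)
    qed
    also have "\<dots> = (q ^ (N * N) * z ^ N) * qpoch (- (q / z)) (q^2) N"
      unfolding qpoch_def prod_mult_power_lessThan[symmetric]
        prod.nat_diff_reindex[of "\<lambda>i. q * z * (q^2) ^ i", symmetric] by (rule prod.distrib)
    finally have 1: "(\<Prod>i<N. q ^ (2*N) + q * z * (q^2) ^ i) = (q ^ (N * N) * z ^ N) * qpoch (- (q / z)) (q^2) N" .
    have "(\<Prod>i<N. q ^ (2*N) + q * z * (q^2) ^ (N + i)) = (\<Prod>i<N. q ^ (2*N) * (1 - (- (q * z)) * (q^2) ^ i))"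
      unfolding power_add power_mult by (intro prod.cong) (simp_all only: distrib_left mult_ac mult_minus_left minus_diff_minus
        diff_minus_eq_add mult_1)
    also have "\<dots> = q ^ (2*N*N) * qpoch (- (q * z)) (q^2) N"
      unfolding prod.distrib qpoch_def by (simp add: power_mult)
    finally have 2: "(\<Prod>i<N. q ^ (2*N) + q * z * (q^2) ^ (N + i)) = q ^ (2*N*N) * qpoch (- (q * z)) (q^2) N" .
    have "q ^ (3*N*N) = q ^ (N*N) * q ^ (2*N*N)" by (simp flip: power_add add: algebra_simps)
    thus ?thesis unfolding prod_lessThan_add 1 2 c_def by (simp add: mult_ac)
  qed
  have "(\<Prod>i<N+N. q ^ (2*N) + q * z * (q^2) ^ i) = (\<Sum>k<N + Suc N. f k)"
    unfolding q_binomial[OF p] f_def by (simp add: lessThan_Suc_atMost)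
  also have "\<dots> = (\<Sum>j<N. f (N - Suc j)) + (\<Sum>j<Suc N. f (N + j))"
    unfolding sum_lessThan_add sum.nat_diff_reindex ..
  also have "(\<Sum>j<Suc N. f (N + j)) = (\<Sum>j<Suc N. c * (qbinom (q^2) (N + N) (N + j) * (q ^ (j * j) * z ^ j)))"
  proof (rule sum.cong[OF refl])
    fix j assume "j \<in> {..<Suc N}"
    then obtain l where l: "N = j + l" using le_Suc_ex[of j N] by auto
    \<comment> \<open>Completing the square: here \<open>l = N - j\<close>, the linear terms in
      \<open>j\<close> cancel, and the constant matches the exponent in \<open>c\<close>.\<close>
    have e: "(N + j) * (N + j) + 2 * N * l = 3*N*N + j * j" unfolding l by (simp add: algebra_simps)
    have "N + N - (N + j) = l" using l by simp
    hence "f (N + j) = qbinom (q^2) (N + N) (N + j) * (q ^ (3*N*N + j * j) * z ^ (N + j))"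
      unfolding f_def using qk[of "N + j" l] e by (simp add: mult.assoc)
    thus "f (N + j) = c * (qbinom (q^2) (N + N) (N + j) * (q ^ (j * j) * z ^ j))"
      by (simp add: c_def power_add mult_ac)
  qed
  also have "(\<Sum>j<N. f (N - Suc j)) = (\<Sum>j<N. c * (qbinom (q^2) (N + N) (N - Suc j) * (q ^ (Suc j * Suc j) / z ^ Suc j)))"
  proof (rule sum.cong[OF refl])
    fix j assume "j \<in> {..<N}"
    then obtain l where l: "N = Suc j + l" using Suc_leI le_Suc_ex by blast
    define s where "s = Suc j"
    have e: "l * l + 2 * N * (N + s) = 3*N*N + s * s" unfolding l s_def[symmetric] by (simp add: algebra_simps)
    have "N - s = l" "N + N - l = N + s" using l by (simp_all add: s_def)
    hence "f (N - s) = qbinom (q^2) (N + N) (N - s) * (q ^ (3*N*N + s * s) * z ^ l)"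
      unfolding f_def using qk[of l "N + s"] e by (simp add: mult.assoc)
    moreover have "z ^ l = z ^ N / z ^ s" using l z by (simp add: s_def power_add)
    ultimately have "f (N - s) = c * (qbinom (q^2) (N + N) (N - s) * (q ^ (s * s) / z ^ s))"
      by (simp add: c_def power_add mult_ac)
    thus "f (N - Suc j) = c * (qbinom (q^2) (N + N) (N - Suc j) * (q ^ (Suc j * Suc j) / z ^ Suc j))"
      unfolding s_def .
  qed
  finally have "c * (qpoch (- (q * z)) (q^2) N * qpoch (- (q / z)) (q^2) N)
    = c * ((\<Sum>j<Suc N. qbinom (q^2) (N + N) (N + j) * (q ^ (j * j) * z ^ j))
     + (\<Sum>j<N. qbinom (q^2) (N + N) (N - Suc j) * (q ^ (Suc j * Suc j) / z ^ Suc j)))"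
    unfolding lhs distrib_left sum_distrib_left by (simp only: add.commute)
  thus ?thesis using c0 by (simp only: mult_cancel_left simp_thms)
qed

text \<open>Independence of both \<open>m\<close> and \<open>k\<close> makes this the dominating
  constant as \<open>N\<close> grows in the triple product.\<close>

lemma qbinom_bounded:
  assumes p: "norm p < 1"
  obtains B where "B \<ge> 0" "\<And>m k. norm (qbinom p m k) \<le> B"
proof -
  obtain c C where c: "c > 0" "C > 0" 
    and lo: "\<And>(x :: nat \<Rightarrow> complex) n. (\<And>i. norm (x i) \<le> norm p ^ Suc i) \<Longrightarrow> c \<le> norm (\<Prod>i<n. 1 - x i)"
    and hi: "\<And>(x :: nat \<Rightarrow> complex) n. (\<And>i. norm (x i) \<le> norm p ^ Suc i) \<Longrightarrow> norm (\<Prod>i<n. 1 - x i) \<le> C"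
    using prod_bounds[of "norm p"] p by auto
  have b: "c \<le> norm (qpoch p p n)" "norm (qpoch p p n) \<le> C" for n
    unfolding qpoch_def by (rule lo hi; simp add: norm_mult norm_power)+
  show ?thesis
  proof (rule that[of "C / (c * c)"])
    show "norm (qbinom p m k) \<le> C / (c * c)" for m k
      unfolding qbinom_def norm_divide norm_mult using b c by (intro frac_le mult_mono) auto
  qed (use c in auto)
qed

text \<open>The term is the \<open>j\<close>-th power of \<open>q ^ j * z\<close>, which tends to 0
  and is thus eventually below 1/2 in norm, whatever \<open>z\<close> is.\<close>

lemma theta_summable:
  fixes q z :: complex
  assumes q: "norm q < 1"
  shows "summable (\<lambda>j. norm (q ^ (j * j) * z ^ j))"
proof (rule summable_comparison_test_ev)
  have "(\<lambda>j. norm q ^ j * norm z) \<longlonglongrightarrow> 0 * norm z"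
    using q by (intro tendsto_intros LIMSEQ_power_zero) auto
  hence "eventually (\<lambda>j. norm q ^ j * norm z < 1/2) sequentially"
    by (intro order_tendstoD(2)[where y = 0]) auto
  thus "eventually (\<lambda>j. norm (norm (q ^ (j * j) * z ^ j)) \<le> (1/2) ^ j) sequentially"
  proof eventually_elim
    case (elim j)
    have "norm (norm (q ^ (j * j) * z ^ j)) = (norm q ^ j * norm z) ^ j"
      by (simp add: norm_mult norm_power power_mult power_mult_distrib)
    also have "\<dots> \<le> (1/2) ^ j" using elim by (intro power_mono) auto
    finally show ?case .
  qed
qed (simp add: summable_geometric)

text \<open>The limit of the finite version: every Gaussian binomial at a fixed distance from the
  centre tends to \<open>1 / E\<close>.\<close>

lemma triple_product_nat:
  fixes q z :: complex
  assumes q: "norm q < 1" "q \<noteq> 0" and z: "z \<noteq> 0"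
  shows "(\<Sum>j. q ^ (j * j) * z ^ j) + (\<Sum>j. q ^ (Suc j * Suc j) / z ^ Suc j)
    = qpoch_inf (q^2) (q^2) * qpoch_inf (- (q * z)) (q^2) * qpoch_inf (- (q / z)) (q^2)"
proof -
  have p: "norm (q^2) < 1" using q by (simp add: norm_power power_less_one_iff)
  define E where "E = qpoch_inf (q^2) (q^2)"
  have E: "E \<noteq> 0" unfolding E_def by (rule qpoch_inf_nonzero[OF p p])
  have Elim: "(\<lambda>n. qpoch (q^2) (q^2) (g n)) \<longlonglongrightarrow> E" if "filterlim g at_top sequentially" for g
    unfolding E_def by (rule filterlim_compose[OF qpoch_tendsto[OF p] that])
  obtain B where B: "B \<ge> 0" "\<And>m k. norm (qbinom (q^2) m k) \<le> B" using qbinom_bounded[OF p] by blast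
  have g1: "filterlim (\<lambda>N. N + N) at_top sequentially" "filterlim (\<lambda>N. N + j) at_top sequentially"
    "filterlim (\<lambda>N. N - j) at_top sequentially" for j :: nat
    by (auto intro: filterlim_minus_const_nat_at_top filterlim_add_const_nat_at_top filterlim_at_top_mono[OF filterlim_ident])
  have lim1: "(\<lambda>N. qbinom (q^2) (N + N) (N + j)) \<longlonglongrightarrow> 1 / E" for j
  proof -
    have "N + N - (N + j) = N - j" for N by simp
    hence "(\<lambda>N. qbinom (q^2) (N + N) (N + j)) = (\<lambda>N. qpoch (q^2) (q^2) (N + N) / (qpoch (q^2) (q^2) (N + j) * qpoch (q^2) (q^2) (N - j)))"
      by (simp add: qbinom_def)
    moreover have "\<dots> \<longlonglongrightarrow> E / (E * E)"
      by (intro tendsto_intros Elim g1) (use E in auto)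
    ultimately show ?thesis using E by simp
  qed
  have lim2: "(\<lambda>N. qbinom (q^2) (N + N) (N - Suc j)) \<longlonglongrightarrow> 1 / E" for j
  proof -
    have "(\<lambda>N. qpoch (q^2) (q^2) (N + N) / (qpoch (q^2) (q^2) (N - Suc j) * qpoch (q^2) (q^2) (N + Suc j))) \<longlonglongrightarrow> E / (E * E)"
      by (intro tendsto_intros Elim g1) (use E in auto)
    moreover have "eventually (\<lambda>N. qpoch (q^2) (q^2) (N + N) / (qpoch (q^2) (q^2) (N - Suc j) * qpoch (q^2) (q^2) (N + Suc j))
        = qbinom (q^2) (N + N) (N - Suc j)) sequentially"
      using eventually_ge_at_top[of "Suc j"]
    proof eventually_elim
      case (elim N)
      hence "N + N - (N - Suc j) = N + Suc j" by simp
      thus ?case by (simp add: qbinom_def)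
    qed
    ultimately show ?thesis using E tendsto_cong by force
  qed
  define u where "u j = q ^ (j * j) * z ^ j" for j
  define v where "v j = q ^ (Suc j * Suc j) / z ^ Suc j" for j
  have us: "summable (\<lambda>j. norm (u j))" unfolding u_def by (rule theta_summable[OF q(1)])
  have vs: "summable (\<lambda>j. norm (v j))"
    using theta_summable[OF q(1), of "1 / z"] unfolding v_def
    by (subst (asm) summable_Suc_iff[symmetric]) (simp add: power_divide)
  \<comment> \<open>Extending the finite sums by zeros turns them into series whose terms depend on
    \<open>N\<close>, the form needed for dominated convergence.\<close>
  define a where "a j N = (if j < Suc N then qbinom (q^2) (N + N) (N + j) * u j else 0)" for j N
  define b where "b j N = (if j < N then qbinom (q^2) (N + N) (N - Suc j) * v j else 0)" for j N
  have A: "(\<lambda>N. \<Sum>j. a j N) \<longlonglongrightarrow> (\<Sum>j. 1 / E * u j)"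
  proof (rule tannery_sequentially(1)[where M = "\<lambda>j. B * norm (u j)"])
    show "(\<lambda>N. a j N) \<longlonglongrightarrow> 1 / E * u j" for j
    proof (rule Lim_transform_eventually[OF tendsto_mult[OF lim1 tendsto_const]])
      show "\<forall>\<^sub>F N in sequentially. qbinom (q^2) (N + N) (N + j) * u j = a j N"
        using eventually_ge_at_top[of j] by eventually_elim (simp add: a_def)
    qed
    show "norm (a j N) \<le> B * norm (u j)" for j N
      using B by (auto simp: a_def norm_mult intro!: mult_right_mono)
  qed (intro summable_mult us)
  have Bl: "(\<lambda>N. \<Sum>j. b j N) \<longlonglongrightarrow> (\<Sum>j. 1 / E * v j)"
  proof (rule tannery_sequentially(1)[where M = "\<lambda>j. B * norm (v j)"])
    show "(\<lambda>N. b j N) \<longlonglongrightarrow> 1 / E * v j" for j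
    proof (rule Lim_transform_eventually[OF tendsto_mult[OF lim2 tendsto_const]])
      show "\<forall>\<^sub>F N in sequentially. qbinom (q^2) (N + N) (N - Suc j) * v j = b j N"
        using eventually_gt_at_top[of j] by eventually_elim (simp add: b_def)
    qed
    show "norm (b j N) \<le> B * norm (v j)" for j N
      using B by (auto simp: b_def norm_mult intro!: mult_right_mono)
  qed (intro summable_mult vs)
  have "(\<Sum>j. a j N) = (\<Sum>j<Suc N. qbinom (q^2) (N + N) (N + j) * u j)" for N
    by (subst suminf_finite[of "{..<Suc N}"]) (auto simp: a_def intro!: sum.cong)
  moreover have "(\<Sum>j. b j N) = (\<Sum>j<N. qbinom (q^2) (N + N) (N - Suc j) * v j)" for N
    by (subst suminf_finite[of "{..<N}"]) (auto simp: b_def intro!: sum.cong)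
  ultimately have "qpoch (- (q * z)) (q^2) N * qpoch (- (q / z)) (q^2) N = (\<Sum>j. a j N) + (\<Sum>j. b j N)" for N
    using finite_triple_product[OF q z, of N] by (simp only: u_def v_def)
  hence "(\<lambda>N. qpoch (- (q * z)) (q^2) N * qpoch (- (q / z)) (q^2) N) \<longlonglongrightarrow> (\<Sum>j. 1 / E * u j) + (\<Sum>j. 1 / E * v j)"
    using tendsto_add[OF A Bl] by simp
  moreover have "(\<lambda>N. qpoch (- (q * z)) (q^2) N * qpoch (- (q / z)) (q^2) N)
      \<longlonglongrightarrow> qpoch_inf (- (q * z)) (q^2) * qpoch_inf (- (q / z)) (q^2)"
    by (intro tendsto_intros qpoch_tendsto p)
  ultimately have "(\<Sum>j. 1 / E * u j) + (\<Sum>j. 1 / E * v j) = qpoch_inf (- (q * z)) (q^2) * qpoch_inf (- (q / z)) (q^2)"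
    by (rule LIMSEQ_unique)
  hence "suminf u + suminf v
      = E * qpoch_inf (- (q * z)) (q^2) * qpoch_inf (- (q / z)) (q^2)"
    unfolding suminf_mult[OF summable_norm_cancel[OF us]] suminf_mult[OF summable_norm_cancel[OF vs]]
    using E by (simp add: field_simps)
  thus ?thesis unfolding u_def v_def E_def .
qed

section \<open>Bilateral theta series\<close>

definition theta_term :: "complex \<Rightarrow> complex \<Rightarrow> int \<Rightarrow> complex" where
  "theta_term q z n = q powi (n * n) * z powi n"

text \<open>An unordered sum over the integers, so that index shifts and lattice substitutions in
  double sums are plain reindexing.\<close>

definition theta :: "complex \<Rightarrow> complex \<Rightarrow> complex" where
  "theta q z = infsum (theta_term q z) UNIV"

lemma theta_term_nonneg: "theta_term q z (int j) = q ^ (j * j) * z ^ j"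
  by (simp add: theta_term_def power_int_def nat_mult_distrib)

lemma theta_term_neg: "theta_term q z (- int (Suc j)) = q ^ (Suc j * Suc j) / z ^ Suc j"
proof -
  have "(- int (Suc j)) * (- int (Suc j)) = int (Suc j * Suc j)" by (simp only: minus_mult_minus of_nat_mult)
  thus ?thesis unfolding theta_term_def by (simp only: power_int_of_nat power_int_minus divide_inverse)
qed

lemma UNIV_int_split: "(UNIV :: int set) = range int \<union> range (\<lambda>j. - int (Suc j))"
proof -
  have "x \<in> range int \<union> range (\<lambda>j. - int (Suc j))" for x
    by (cases x rule: int_cases) auto
  thus ?thesis by auto
qed

lemma has_sum_int_split:
  fixes f :: "int \<Rightarrow> 'a :: banach"
  assumes "summable (\<lambda>j. norm (f (int j)))" "summable (\<lambda>j. norm (f (- int (Suc j))))"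
  shows "(f has_sum ((\<Sum>j. f (int j)) + (\<Sum>j. f (- int (Suc j))))) UNIV"
  unfolding UNIV_int_split
proof (rule has_sum_Un_disjoint)
  have "((\<lambda>j. f (int j)) has_sum (\<Sum>j. f (int j))) UNIV"
    by (rule norm_summable_imp_has_sum[OF assms(1) summable_sums[OF summable_norm_cancel[OF assms(1)]]])
  thus "(f has_sum (\<Sum>j. f (int j))) (range int)"
    by (subst has_sum_reindex) (auto simp: o_def)
  have "((\<lambda>j. f (- int (Suc j))) has_sum (\<Sum>j. f (- int (Suc j)))) UNIV"
    by (rule norm_summable_imp_has_sum[OF assms(2) summable_sums[OF summable_norm_cancel[OF assms(2)]]])
  thus "(f has_sum (\<Sum>j. f (- int (Suc j)))) (range (\<lambda>j. - int (Suc j)))"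
    by (subst has_sum_reindex) (auto simp: o_def inj_on_def)
qed auto

lemma theta_summands_summable:
  assumes "norm q < 1"
  shows "summable (\<lambda>j. norm (theta_term q z (int j)))" "summable (\<lambda>j. norm (theta_term q z (- int (Suc j))))"
  unfolding theta_term_nonneg theta_term_neg using theta_summable[OF assms, of z] theta_summable[OF assms, of "1 / z"]
  by (simp, subst (asm) (2) summable_Suc_iff[symmetric], simp add: power_divide)

theorem jacobi_triple_product:
  assumes "norm q < 1" "q \<noteq> 0" "z \<noteq> 0"
  shows "theta q z = qpoch_inf (q^2) (q^2) * qpoch_inf (- (q * z)) (q^2) * qpoch_inf (- (q / z)) (q^2)"
  using infsumI[OF has_sum_int_split[OF theta_summands_summable[OF assms(1)]]] triple_product_nat[OF assms]
  unfolding theta_def theta_term_nonneg theta_term_neg by simp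

lemma theta_abs_summable:
  assumes "norm q < 1"
  shows "(\<lambda>n. norm (theta_term q z n)) summable_on UNIV"
  by (rule has_sum_imp_summable[OF has_sum_int_split])
     (simp_all only: real_norm_def abs_norm_cancel theta_summands_summable[OF assms])

lemma theta_has_sum:
  assumes "norm q < 1"
  shows "(theta_term q z has_sum theta q z) UNIV"
  unfolding theta_def by (rule has_sum_infsum[OF abs_summable_summable[OF theta_abs_summable[OF assms]]])

text \<open>Quasi-periodicity, from the index shift by one and (n + 1)^2 = n^2 + 2 n + 1.\<close>

lemma theta_shift:
  assumes q: "norm q < 1" "q \<noteq> 0" and z: "z \<noteq> 0"
  shows "theta q (q^2 * z) = theta q z / (q * z)"
proof -
  have "theta_term q z (n + 1) = q * z * theta_term q (q^2 * z) n" for n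
  proof -
    have "(n + 1) * (n + 1) = n * n + 2 * n + 1" by (simp add: algebra_simps)
    hence "q powi ((n + 1) * (n + 1)) = q powi (n * n) * (q^2) powi n * q"
      using q by (simp add: power_int_add power_int_mult)
    thus ?thesis using z by (simp add: theta_term_def power_int_add power_int_mult_distrib mult_ac)
  qed
  moreover have "((\<lambda>n. theta_term q z (n + 1)) has_sum theta q z) UNIV"
    using theta_has_sum[OF q(1), of z]
    by (rule has_sum_reindex_bij_witness[THEN iffD1, of _ "\<lambda>n. n + 1" "\<lambda>n. n - 1", rotated -1]) auto
  ultimately have "((\<lambda>n. q * z * theta_term q (q^2 * z) n) has_sum theta q z) UNIV" by simp
  moreover have "((\<lambda>n. q * z * theta_term q (q^2 * z) n) has_sum (q * z * theta q (q^2 * z))) UNIV"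
    by (intro has_sum_cmult_right theta_has_sum q)
  ultimately show ?thesis using has_sum_unique q z by (fastforce simp: field_simps)
qed

text \<open>Absolute convergence makes the double family summable over all pairs, so that the pairs
  may afterwards be regrouped freely.\<close>

lemma has_sum_product:
  fixes f g :: "int \<Rightarrow> complex"
  assumes "(f has_sum a) UNIV" "(g has_sum b) UNIV" "(\<lambda>n. norm (f n)) summable_on UNIV" "(\<lambda>n. norm (g n)) summable_on UNIV"
  shows "((\<lambda>(m, n). f m * g n) has_sum (a * b)) UNIV"
proof -
  have "(\<lambda>(m, n). norm (f m) * norm (g n)) summable_on (SIGMA m:UNIV. UNIV)"
  proof (rule summable_on_SigmaI)
    show "((\<lambda>n. case (m, n) of (m, n) \<Rightarrow> norm (f m) * norm (g n)) has_sum (norm (f m) * infsum (\<lambda>n. norm (g n)) UNIV)) UNIV" for m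
      using has_sum_cmult_right[OF has_sum_infsum[OF assms(4)]] by simp
    show "(\<lambda>m. norm (f m) * infsum (\<lambda>n. norm (g n)) UNIV) summable_on UNIV"
      by (rule summable_on_cmult_left[OF assms(3)])
  qed auto
  hence "(\<lambda>x. norm (case x of (m, n) \<Rightarrow> f m * g n)) summable_on UNIV \<times> UNIV"
    by (simp add: case_prod_unfold norm_mult)
  hence "(\<lambda>(m, n). f m * g n) summable_on UNIV \<times> UNIV" by (rule abs_summable_summable)
  moreover have "((\<lambda>n. case (m, n) of (m, n) \<Rightarrow> f m * g n) has_sum (f m * b)) UNIV" for m
    using has_sum_cmult_right[OF assms(2)] by simp
  moreover have "((\<lambda>m. f m * b) has_sum (a * b)) UNIV"
    by (rule has_sum_cmult_left[OF assms(1)])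
  ultimately have "((\<lambda>(m, n). f m * g n) has_sum (a * b)) (UNIV \<times> UNIV)"
    by (intro has_sum_SigmaI[where g = "\<lambda>m. f m * b"])
  thus ?thesis by simp
qed

text \<open>Splitting \<open>(m, n)\<close> by the parity of \<open>m + n\<close> and substituting \<open>m + n\<close>, \<open>m - n\<close>
  diagonalises the exponent, since \<open>(s + t)\<^sup>2 + (s - t)\<^sup>2 = 2 s\<^sup>2 + 2 t\<^sup>2\<close>.\<close>

theorem theta_mult:
  assumes q: "norm q < 1" "q \<noteq> 0" and x: "x \<noteq> 0" and y: "y \<noteq> 0"
  shows "theta q x * theta q y = theta (q^2) (x * y) * theta (q^2) (x / y)
    + q * x * (theta (q^2) (q^2 * (x * y)) * theta (q^2) (q^2 * (x / y)))"
proof -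
  have p: "norm (q^2) < 1" using q by (simp add: norm_power power_less_one_iff)
  define F where "F = (\<lambda>(m, n). theta_term q x m * theta_term q y n)"
  define ev where "ev = (\<lambda>(s::int, t::int). (s + t, s - t))"
  define od where "od = (\<lambda>(s::int, t::int). (s + t + 1, s - t))"
  have inj: "inj ev" "inj od" by (auto simp: ev_def od_def inj_on_def)
  have U: "(UNIV :: (int \<times> int) set) = range ev \<union> range od"
  proof -
    have "(m, n) \<in> range ev \<union> range od" for m n
    proof (cases "even (m + n)")
      case True
      then obtain s where s: "m + n = 2 * s" by (elim evenE)
      hence "(m, n) = ev (s, m - s)" by (simp add: ev_def)
      thus ?thesis by blast
    next
      case False
      then obtain s where s: "m + n = 2 * s + 1" by (elim oddE)
      hence "(m, n) = od (s, m - s - 1)" by (simp add: od_def)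
      thus ?thesis by blast
    qed
    thus ?thesis by auto
  qed
  have disj: "range ev \<inter> range od = {}"
  proof -
    have "ev a \<noteq> od b" for a b
    proof
      obtain s t s' t' where ab: "a = (s, t)" "b = (s', t')" by (cases a, cases b)
      assume "ev a = od b"
      hence "s + t = s' + t' + 1" "s - t = s' - t'" by (auto simp: ev_def od_def ab)
      hence "2 * s = 2 * s' + 1" by linarith
      thus False by presburger
    qed
    thus ?thesis by blast
  qed
  have q2: "(q^2) powi n = q powi (2 * n)" for n by (simp add: power_int_mult)
  have add: "q powi a * q powi b = q powi (a + b)" for a b using q by (simp add: power_int_add)
  have Fev: "F (ev (s, t)) = theta_term (q^2) (x * y) s * theta_term (q^2) (x / y) t" for s t
  proof -
    have "(s + t) * (s + t) + (s - t) * (s - t) = 2 * (s * s) + 2 * (t * t)" by (simp add: algebra_simps)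
    hence e: "q powi ((s + t) * (s + t)) * q powi ((s - t) * (s - t)) = (q^2) powi (s * s) * (q^2) powi (t * t)"
      unfolding q2 add by (rule arg_cong)
    have "F (ev (s, t)) = (q powi ((s + t) * (s + t)) * q powi ((s - t) * (s - t))) * (x powi (s + t) * y powi (s - t))"
      by (simp add: F_def ev_def theta_term_def)
    thus ?thesis unfolding e using x y
      by (simp add: theta_term_def power_int_add power_int_diff power_int_mult_distrib power_int_divide_distrib)
  qed
  have Fod: "F (od (s, t)) = q * x * (theta_term (q^2) (q^2 * (x * y)) s * theta_term (q^2) (q^2 * (x / y)) t)" for s t
  proof -
    \<comment> \<open>In the odd class a linear part 2 s + 2 t + 1 is left over. It becomes the
      shift by \<open>q^2\<close> in both theta arguments and the prefactor
      \<open>q\<close>.\<close>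
    have "(s + t + 1) * (s + t + 1) + (s - t) * (s - t) = 2 * (s * s) + 2 * (t * t) + (2 * s + 2 * t + 1)"
      by (simp add: algebra_simps)
    hence "q powi ((s + t + 1) * (s + t + 1)) * q powi ((s - t) * (s - t))
        = q powi (2 * (s * s) + 2 * (t * t) + (2 * s + 2 * t + 1))"
      unfolding add by (rule arg_cong)
    also have "\<dots> = (q^2) powi (s * s) * (q^2) powi (t * t) * (q^2) powi s * (q^2) powi t * q powi 1"
      unfolding q2 add by (rule arg_cong) simp
    finally have e: "q powi ((s + t + 1) * (s + t + 1)) * q powi ((s - t) * (s - t)) = \<dots>" .
    have "F (od (s, t)) = (q powi ((s + t + 1) * (s + t + 1)) * q powi ((s - t) * (s - t))) * (x powi (s + t + 1) * y powi (s - t))"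
      by (simp add: F_def od_def theta_term_def)
    thus ?thesis unfolding e using x y
      by (simp add: theta_term_def power_int_add power_int_diff power_int_mult_distrib power_int_divide_distrib)
  qed
  have prod2: "((\<lambda>(s, t). theta_term (q^2) u s * theta_term (q^2) v t) has_sum (theta (q^2) u * theta (q^2) v)) UNIV" for u v
    by (intro has_sum_product theta_has_sum theta_abs_summable p)
  have "(F has_sum (theta (q^2) (x * y) * theta (q^2) (x / y))) (range ev)"
  proof -
    have "F \<circ> ev = (\<lambda>(s, t). theta_term (q^2) (x * y) s * theta_term (q^2) (x / y) t)"
      by (auto simp: fun_eq_iff Fev)
    thus ?thesis unfolding has_sum_reindex[OF inj(1)] using prod2 by simp
  qed
  moreover have "(F has_sum (q * x * (theta (q^2) (q^2 * (x * y)) * theta (q^2) (q^2 * (x / y))))) (range od)"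
  proof -
    have "F \<circ> od = (\<lambda>p. q * x * (case p of (s, t) \<Rightarrow> theta_term (q^2) (q^2 * (x * y)) s * theta_term (q^2) (q^2 * (x / y)) t))"
      by (auto simp: fun_eq_iff Fod)
    thus ?thesis unfolding has_sum_reindex[OF inj(2)] using has_sum_cmult_right[OF prod2] by simp
  qed
  ultimately have "(F has_sum (theta (q^2) (x * y) * theta (q^2) (x / y)
      + q * x * (theta (q^2) (q^2 * (x * y)) * theta (q^2) (q^2 * (x / y))))) UNIV"
    using has_sum_Un_disjoint[OF _ _ disj, folded U] by blast
  moreover have "(F has_sum (theta q x * theta q y)) UNIV"
    unfolding F_def by (intro has_sum_product theta_has_sum theta_abs_summable q)
  ultimately show ?thesis using has_sum_unique by blast
qed

section \<open>Theta quotients as Lambert series\<close>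

lemma qpoch_inf_mult_uminus:
  assumes q: "norm q < 1"
  shows "qpoch_inf x q * qpoch_inf (- x) q = qpoch_inf (x^2) (q^2)"
proof (rule LIMSEQ_unique)
  have q2: "norm (q^2) < 1" using q by (simp add: norm_power power_less_one_iff)
  show "(\<lambda>n. qpoch x q n * qpoch (- x) q n) \<longlonglongrightarrow> qpoch_inf x q * qpoch_inf (- x) q"
    by (intro tendsto_intros qpoch_tendsto q)
  have "qpoch x q n * qpoch (- x) q n = qpoch (x^2) (q^2) n" for n
    unfolding qpoch_def prod.distrib[symmetric]
    by (intro prod.cong refl) (simp add: algebra_simps power2_eq_square power_mult_distrib)
  thus "(\<lambda>n. qpoch x q n * qpoch (- x) q n) \<longlonglongrightarrow> qpoch_inf (x^2) (q^2)"
    using qpoch_tendsto[OF q2] by simp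
qed

lemma qpoch_inf_split_parity:
  assumes q: "norm q < 1"
  shows "qpoch_inf x q = qpoch_inf x (q^2) * qpoch_inf (x * q) (q^2)"
proof (rule LIMSEQ_unique)
  have q2: "norm (q^2) < 1" using q by (simp add: norm_power power_less_one_iff)
  show "(\<lambda>n. qpoch x (q^2) n * qpoch (x * q) (q^2) n) \<longlonglongrightarrow> qpoch_inf x (q^2) * qpoch_inf (x * q) (q^2)"
    by (intro tendsto_intros qpoch_tendsto q2)
  have "qpoch x (q^2) n * qpoch (x * q) (q^2) n = qpoch x q (2 * n)" for n
    by (induction n) (simp_all add: qpoch_Suc mult_ac flip: power_mult)
  moreover have "(\<lambda>n. qpoch x q (2 * n)) \<longlonglongrightarrow> qpoch_inf x q"
    by (rule filterlim_compose[OF qpoch_tendsto[OF q]]) (rule mult_nat_left_at_top, simp)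
  ultimately show "(\<lambda>n. qpoch x (q^2) n * qpoch (x * q) (q^2) n) \<longlonglongrightarrow> qpoch_inf x q"
    by simp
qed

section \<open>Cube roots of unity\<close>

lemma omega_cube: "omega ^ 3 = 1"
proof -
  have "omega ^ 3 = exp (of_nat 3 * (2 * of_real pi * \<i> / 3))"
    unfolding omega_def by (rule exp_of_nat_mult[symmetric])
  also have "\<dots> = exp (2 * of_real pi * \<i>)" by (rule arg_cong[of _ _ exp]) simp
  also have "\<dots> = 1" by (rule exp_two_pi_i)
  finally show ?thesis .
qed

lemma omega_neq_1: "omega \<noteq> 1"
proof
  assume "omega = 1"
  hence "Re omega = 1" by simp
  hence "cos (2 * pi / 3) = 1" by (simp add: omega_def Re_exp)
  moreover have "cos (2 * pi / 3) < cos 0" by (rule cos_monotone_0_pi) auto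
  ultimately show False by simp
qed

lemma omega_sum: "1 + omega + omega^2 = 0"
proof -
  have "(1 - omega) * (1 + omega + omega^2) = 0"
    using omega_cube by (simp add: algebra_simps power2_eq_square power3_eq_cube)
  thus ?thesis using omega_neq_1 by simp
qed

lemma omega_pow_4: "(omega^2)^2 = omega"
proof -
  have "(omega^2)^2 = omega^3 * omega" by (simp add: power2_eq_square power3_eq_cube)
  thus ?thesis by (simp add: omega_cube)
qed

lemma omega_sq: "omega^2 = - 1 - omega"
  using omega_sum by (simp add: eq_neg_iff_add_eq_0 algebra_simps)

lemma norm_omega [simp]: "norm omega = 1"
  by (simp add: omega_def)

lemma omega_nonzero [simp]: "omega \<noteq> 0"
  using norm_omega by fastforce

text \<open>Factor by factor this is (1 - t) (1 - \<omega> t) (1 - \<omega>^2 t) = 1 - t^3. It links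
  products in base \<open>q^3\<close> to those at cube roots of unity.\<close>

lemma qpoch_inf_cube:
  assumes q: "norm q < 1"
  shows "qpoch_inf x q * qpoch_inf (omega * x) q * qpoch_inf (omega^2 * x) q = qpoch_inf (x^3) (q^3)"
proof (rule LIMSEQ_unique)
  have q3: "norm (q^3) < 1" using q by (simp add: norm_power power_less_one_iff)
  show "(\<lambda>n. qpoch x q n * qpoch (omega * x) q n * qpoch (omega^2 * x) q n)
      \<longlonglongrightarrow> qpoch_inf x q * qpoch_inf (omega * x) q * qpoch_inf (omega^2 * x) q"
    by (intro tendsto_intros qpoch_tendsto q)
  have "(1 - t) * (1 - omega * t) * (1 - omega^2 * t) = 1 - t^3" for t
  proof -
    have "(1 - t) * (1 - omega * t) * (1 - omega^2 * t)
        = 1 - t * (1 + omega + omega^2) + omega * t^2 * (1 + omega + omega^2) - omega^3 * t^3"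
      by (simp add: algebra_simps power2_eq_square power3_eq_cube)
    thus ?thesis by (simp add: omega_sum omega_cube)
  qed
  from this[of "x * q ^ _"] have "qpoch x q n * qpoch (omega * x) q n * qpoch (omega^2 * x) q n = qpoch (x^3) (q^3) n" for n
    unfolding qpoch_def prod.distrib[symmetric]
    by (intro prod.cong refl) (simp add: mult.assoc power_mult_distrib flip: power_mult, simp add: mult_ac)
  thus "(\<lambda>n. qpoch x q n * qpoch (omega * x) q n * qpoch (omega^2 * x) q n) \<longlonglongrightarrow> qpoch_inf (x^3) (q^3)"
    using qpoch_tendsto[OF q3] by simp
qed

lemma qpoch_inf_zero [simp]: "qpoch_inf 0 q = 1"
  by (simp add: qpoch_inf_def)

section \<open>The product formula for psi\<close>

lemma psi_0 [simp]: "psi 0 = 1"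
proof -
  have "(0::complex) ^ (n * (n + 1) div 2) = (if n = 0 then 1 else 0)" for n :: nat
  proof (cases n)
    case (Suc k)
    hence "n * (n + 1) div 2 > 0" by (simp add: div_greater_zero_iff)
    thus ?thesis using Suc by simp
  qed simp
  thus ?thesis unfolding psi_def by (subst suminf_finite[of "{0}"]) auto
qed

text \<open>The triple product with nome and argument both equal to a square root \<open>s\<close>
  of \<open>q\<close>: the two halves of the bilateral series coincide, each being
  \<open>psi q\<close>.\<close>

theorem psi_product:
  assumes q: "norm q < 1"
  shows "psi q = qpoch_inf (q^2) (q^2) / qpoch_inf q (q^2)"
proof (cases "q = 0")
  case False
  define s where "s = csqrt q"
  have s: "s^2 = q" by (simp add: s_def)
  have s0: "s \<noteq> 0" using s False by auto
  have s1: "norm s < 1" using q by (simp add: s_def norm_csqrt real_sqrt_lt_1_iff)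
  have q2: "norm (q^2) < 1" using q by (simp add: norm_power power_less_one_iff)
  have ev: "2 * (j * (j + 1) div 2) = j * j + j" for j :: nat
    by (simp add: algebra_simps)
  have pw: "q ^ (j * (j + 1) div 2) = s ^ (j * j + j)" for j :: nat
    unfolding s[symmetric] power_mult[symmetric] ev ..
  have "s ^ (j * j) * s ^ j = q ^ (j * (j + 1) div 2)" for j
    unfolding pw by (simp add: power_add)
  moreover have "s ^ (Suc j * Suc j) / s ^ Suc j = q ^ (j * (j + 1) div 2)" for j
    unfolding pw using s0 by (simp add: power_add)
  ultimately have "2 * psi q = qpoch_inf q q * qpoch_inf (- q) q * qpoch_inf (- 1) q"
    using triple_product_nat[OF s1 s0 s0] s0 s unfolding psi_def by (simp add: power2_eq_square)
  also have "qpoch_inf (- 1) q = 2 * qpoch_inf (- q) q"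
    using qpoch_inf_shift[OF q, of "-1"] by simp
  finally have "psi q = (qpoch_inf q q * qpoch_inf (- q) q) * qpoch_inf (- q) q" by simp
  also have "qpoch_inf q q * qpoch_inf (- q) q = qpoch_inf (q^2) (q^2)"
    by (rule qpoch_inf_mult_uminus[OF q])
  finally have psi: "psi q = qpoch_inf (q^2) (q^2) * qpoch_inf (- q) q" .
  have nz: "qpoch_inf (q^2) (q^2) \<noteq> 0" "qpoch_inf q (q^2) \<noteq> 0"
    using qpoch_inf_nonzero q2 q by auto
  \<comment> \<open>Splitting by parity and multiplying by the product at \<open>- q\<close> leads
    to Euler's identity (q; q^2) (-q; q) = 1 for the infinite products.\<close>
  have "qpoch_inf q (q^2) * qpoch_inf (q^2) (q^2) * qpoch_inf (- q) q = qpoch_inf (q^2) (q^2)"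
    using qpoch_inf_split_parity[OF q, of q] qpoch_inf_mult_uminus[OF q, of q] by (simp add: power2_eq_square)
  hence "qpoch_inf q (q^2) * qpoch_inf (- q) q = 1" using nz by simp
  thus ?thesis unfolding psi using nz by (simp add: field_simps)
qed simp

text \<open>The left side consists of the monomials of degree at least two in the
  \<open>u k\<close>; the right side is the same expansion with norms in place of signed
  values.\<close>

lemma prod_minus_linear_bound:
  fixes u :: "nat \<Rightarrow> complex"
  shows "norm ((\<Prod>k<n. 1 - u k) - 1 + (\<Sum>k<n. u k)) \<le> (\<Prod>k<n. 1 + norm (u k)) - 1 - (\<Sum>k<n. norm (u k))"
proof (induction n)
  case (Suc n)
  have "norm ((\<Prod>k<n. 1 - u k) - 1) \<le> (\<Prod>k<n. 1 + norm (u k)) - 1"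
    using norm_prod_minus1_le_prod_minus1[of "\<lambda>k. - u k" "{..<n}"] by simp
  hence "norm (u n * ((\<Prod>k<n. 1 - u k) - 1)) \<le> norm (u n) * ((\<Prod>k<n. 1 + norm (u k)) - 1)"
    unfolding norm_mult by (intro mult_left_mono) auto
  moreover have "(\<Prod>k<Suc n. 1 - u k) - 1 + (\<Sum>k<Suc n. u k)
      = ((\<Prod>k<n. 1 - u k) - 1 + (\<Sum>k<n. u k)) - u n * ((\<Prod>k<n. 1 - u k) - 1)"
    by (simp add: algebra_simps)
  ultimately have "norm ((\<Prod>k<Suc n. 1 - u k) - 1 + (\<Sum>k<Suc n. u k))
     \<le> ((\<Prod>k<n. 1 + norm (u k)) - 1 - (\<Sum>k<n. norm (u k))) + norm (u n) * ((\<Prod>k<n. 1 + norm (u k)) - 1)"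
    using norm_triangle_ineq4 Suc by (smt (verit, best))
  thus ?case by (simp add: algebra_simps)
qed simp

text \<open>The remainder beyond the linear term is at most \<open>exp s - 1 - s\<close>, hence at
  most \<open>s^2\<close> for \<open>s\<close> in the unit interval. This is uniform in the number
  of factors and so survives the passage to the infinite product.\<close>

lemma prodinf_has_derivative_0:
  fixes c :: "nat \<Rightarrow> complex"
  assumes c: "summable (\<lambda>k. norm (c k))"
  shows "((\<lambda>t. \<Prod>k. 1 - t * c k) has_field_derivative - (\<Sum>k. c k)) (at 0)"
proof -
  define F where "F t = (\<Prod>k. 1 - t * c k)" for t
  define S where "S = (\<Sum>k. norm (c k))"
  have S0: "S \<ge> 0" unfolding S_def using c by (intro suminf_nonneg) auto
  have bound: "norm (F t - 1 + t * (\<Sum>k. c k)) \<le> (norm t * S)^2" if t: "norm t * S \<le> 1" for t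
  proof (rule LIMSEQ_le_const2)
    have "summable (\<lambda>k. norm (t * c k))" unfolding norm_mult using c by (rule summable_mult)
    hence "(\<lambda>n. \<Prod>k<n. 1 - t * c k) \<longlonglongrightarrow> F t" unfolding F_def by (rule prod_one_minus_tendsto)
    moreover have "(\<lambda>n. t * (\<Sum>k<n. c k)) \<longlonglongrightarrow> t * (\<Sum>k. c k)"
      by (intro tendsto_mult tendsto_const summable_LIMSEQ summable_norm_cancel[OF c])
    ultimately show "(\<lambda>n. norm ((\<Prod>k<n. 1 - t * c k) - 1 + t * (\<Sum>k<n. c k))) \<longlonglongrightarrow> norm (F t - 1 + t * (\<Sum>k. c k))"
      by (intro tendsto_norm tendsto_add tendsto_diff tendsto_const)
    have "norm ((\<Prod>k<n. 1 - t * c k) - 1 + t * (\<Sum>k<n. c k)) \<le> (norm t * S)^2" for n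
    proof -
      define s where "s = (\<Sum>k<n. norm (t * c k))"
      have s0: "0 \<le> s" by (simp add: s_def sum_nonneg)
      have "s = norm t * (\<Sum>k<n. norm (c k))" by (simp add: s_def norm_mult sum_distrib_left)
      also have "\<dots> \<le> norm t * S"
        unfolding S_def using c by (intro mult_left_mono sum_le_suminf) auto
      finally have sS: "s \<le> norm t * S" .
      have "norm ((\<Prod>k<n. 1 - t * c k) - 1 + t * (\<Sum>k<n. c k)) \<le> (\<Prod>k<n. 1 + norm (t * c k)) - 1 - s"
        using prod_minus_linear_bound[of "\<lambda>k. t * c k" n] by (simp add: s_def sum_distrib_left)
      also have "(\<Prod>k<n. 1 + norm (t * c k)) \<le> exp s"
        unfolding s_def by (intro prod_le_exp_sum) auto
      also have "exp s \<le> 1 + s + s^2" using s0 sS t by (intro exp_bound) auto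
      also have "s^2 \<le> (norm t * S)^2" using s0 sS by (intro power_mono)
      finally show ?thesis by simp
    qed
    thus "\<exists>N. \<forall>n\<ge>N. norm ((\<Prod>k<n. 1 - t * c k) - 1 + t * (\<Sum>k<n. c k)) \<le> (norm t * S)^2" by blast
  qed
  have F0: "F 0 = 1" by (simp add: F_def)
  have "((\<lambda>h. (F (0 + h) - F 0) / h - (- (\<Sum>k. c k))) \<longlongrightarrow> 0) (at 0)"
  proof (rule Lim_null_comparison)
    have "((\<lambda>h::complex. norm h * S) \<longlongrightarrow> norm (0::complex) * S) (at 0)" by (intro tendsto_intros)
    hence "eventually (\<lambda>h::complex. norm h * S < 1) (at 0)" by (rule order_tendstoD(2)) simp
    thus "eventually (\<lambda>h. norm ((F (0 + h) - F 0) / h - (- (\<Sum>k. c k))) \<le> norm h * S^2) (at 0)"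
      using eventually_neq_at_within[of 0]
    proof eventually_elim
      case (elim h)
      have "(F (0 + h) - F 0) / h - (- (\<Sum>k. c k)) = (F h - 1 + h * (\<Sum>k. c k)) / h"
        using elim F0 by (simp add: field_simps)
      also have "norm \<dots> \<le> (norm h * S)^2 / norm h"
        unfolding norm_divide using bound[of h] elim by (intro divide_right_mono) auto
      also have "\<dots> = norm h * S^2" using elim by (simp add: power2_eq_square)
      finally show ?case .
    qed
    have "((\<lambda>h::complex. norm h * S^2) \<longlongrightarrow> norm (0::complex) * S^2) (at 0)" by (intro tendsto_intros)
    thus "((\<lambda>h::complex. norm h * S^2) \<longlongrightarrow> 0) (at 0)" by simp
  qed
  hence "((\<lambda>h. (F (0 + h) - F 0) / h) \<longlongrightarrow> - (\<Sum>k. c k)) (at 0)" by (rule LIM_zero_cancel)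
  thus ?thesis unfolding DERIV_def F_def by simp
qed

section \<open>The three-term theta relation and its first order term\<close>

definition theta_odd :: "complex \<Rightarrow> complex \<Rightarrow> complex" where
  "theta_odd q x = qpoch_inf (q * x) (q^2) * qpoch_inf (q / x) (q^2)"

text \<open>Up to the factor \<open>qpoch_inf (q^2) (q^2)\<close>, \<open>theta_odd q x\<close> is
  \<open>theta q (- x)\<close>, and \<open>(1 - 1 / x) * theta_even q x\<close> is
  \<open>theta q (- (q * x))\<close>. Removing the factor that vanishes at \<open>x = 1\<close>
  keeps \<open>theta_even\<close> usable there.\<close>

definition theta_even :: "complex \<Rightarrow> complex \<Rightarrow> complex" where
  "theta_even q x = qpoch_inf (q^2 * x) (q^2) * qpoch_inf (q^2 / x) (q^2)"

text \<open>By \<open>theta_mult\<close>, every product involved is bilinear in the pairs of values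
  of \<open>A\<close> at \<open>x^2\<close>, \<open>p * x^2\<close>, at \<open>y^2\<close>,
  \<open>p * y^2\<close>, and at \<open>1\<close>, \<open>p\<close>. Written in these six values the
  relation is an elementary identity in which the mixed terms cancel.\<close>

theorem theta_three_term:
  assumes q: "norm q < 1" and x: "x \<noteq> 0" and y: "y \<noteq> 0"
  shows "theta_odd q (x * y) * theta_odd q (x / y) * (theta_odd q 1)^2
    = (theta_odd q x)^2 * (theta_odd q y)^2
      - q * ((1 - x)^2 / x) * ((1 - y)^2 / y) * (theta_even q x)^2 * (theta_even q y)^2"
proof (cases "q = 0")
  case True
  thus ?thesis by (simp add: theta_odd_def theta_even_def)
next
  case q0: False
  define p where "p = q^2"
  define E where "E = qpoch_inf p p"
  have p: "norm p < 1" "p \<noteq> 0" using q q0 by (auto simp: p_def norm_power power_less_one_iff)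
  have E: "E \<noteq> 0" unfolding E_def by (rule qpoch_inf_nonzero[OF p(1) p(1)])
  have T: "theta q (- z) = E * theta_odd q z" if "z \<noteq> 0" for z
    using jacobi_triple_product[OF q q0, of "- z"] that by (simp add: E_def p_def theta_odd_def)
  have Tq: "theta q (- (q * z)) = E * ((1 - 1 / z) * theta_even q z)" if z: "z \<noteq> 0" for z
    using jacobi_triple_product[OF q q0, of "- (q * z)"] z q0 qpoch_inf_shift[OF p(1), of "1 / z"]
    by (simp add: E_def p_def theta_even_def power2_eq_square mult_ac)
  define A where "A = theta p"
  have shift: "A (p * (p * z)) = A z / (p * z)" if "z \<noteq> 0" for z
    using theta_shift[OF p that] by (simp add: A_def power2_eq_square mult_ac)
  have mult: "theta q (- u) * theta q (- v) = A (u * v) * A (u / v) - q * u * (A (p * (u * v)) * A (p * (u / v)))"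
    if "u \<noteq> 0" "v \<noteq> 0" for u v
    using theta_mult[OF q q0, of "- u" "- v"] that by (simp add: A_def p_def)
  have sq: "(theta q (- z))^2 = A (z^2) * A 1 - q * z * (A (p * z^2) * A p)" if "z \<noteq> 0" for z
    using mult[OF that that] that by (simp add: power2_eq_square)
  \<comment> \<open>Shifting the argument by \<open>q\<close> exchanges the two components of the
    pair, by the quasi-periodicity of \<open>A\<close>.\<close>
  have sqq: "(theta q (- (q * z)))^2 = A (p * z^2) * A 1 - A (z^2) * A p / z" if z: "z \<noteq> 0" for z
  proof -
    have e: "(q * z)^2 = p * z^2" by (simp add: p_def power_mult_distrib)
    have "(theta q (- (q * z)))^2 = A (p * z^2) * A 1 - q * (q * z) * (A (z^2) / (p * z^2) * A p)"
      using sq[of "q * z"] z q0 shift[of "z^2"] unfolding e by simp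
    also have "q * (q * z) * (A (z^2) / (p * z^2) * A p) = A (z^2) * A p / z"
      using z q0 by (simp add: p_def power2_eq_square)
    finally show ?thesis .
  qed
  have r1: "theta q (- (x * y)) * theta q (- (x / y)) = A (x^2) * A (y^2) - q * (x * y) * (A (p * x^2) * A (p * y^2))"
  proof -
    have "x * y * (x / y) = x^2" "x * y / (x / y) = y^2" using x y by (simp_all add: power2_eq_square)
    thus ?thesis using mult[of "x * y" "x / y"] x y by simp
  qed
  have r2: "(theta q (- 1))^2 = (A 1)^2 - q * (A p)^2"
    using sq[of 1] by (simp add: power2_eq_square)
  have "theta q (- (x * y)) * theta q (- (x / y)) * (theta q (- 1))^2
      = (theta q (- x))^2 * (theta q (- y))^2 - q * x * y * ((theta q (- (q * x)))^2 * (theta q (- (q * y)))^2)"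
    unfolding r1 r2 sq[OF x] sq[OF y] sqq[OF x] sqq[OF y] using x y
    by (simp add: field_simps power2_eq_square)
  hence "E^4 * (theta_odd q (x * y) * theta_odd q (x / y) * (theta_odd q 1)^2)
    = E^4 * ((theta_odd q x)^2 * (theta_odd q y)^2
      - q * x * y * (((1 - 1 / x) * theta_even q x)^2 * ((1 - 1 / y) * theta_even q y)^2))"
    using T[of "x * y"] T[of "x / y"] T[of 1] T[OF x] T[OF y] Tq[OF x] Tq[OF y] x y
    by (simp add: power_mult_distrib algebra_simps power2_eq_square eval_nat_numeral)
  hence "theta_odd q (x * y) * theta_odd q (x / y) * (theta_odd q 1)^2
    = (theta_odd q x)^2 * (theta_odd q y)^2
      - q * (x * (1 - 1 / x)^2) * (y * (1 - 1 / y)^2) * (theta_even q x)^2 * (theta_even q y)^2"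
    using E by (simp add: power_mult_distrib mult_ac)
  moreover have "z * (1 - 1 / z)^2 = (1 - z)^2 / z" if "z \<noteq> 0" for z :: complex
    using that by (simp add: field_simps power2_eq_square)
  ultimately show ?thesis using x y by simp
qed

text \<open>The quotient of \<open>qpoch_inf (w * y) p * qpoch_inf (w / y) p\<close> by its value at
  \<open>y = 1\<close>, as a function of \<open>t = (1 - y)^2 / y\<close>.\<close>

definition koebe_prod :: "complex \<Rightarrow> complex \<Rightarrow> complex \<Rightarrow> complex" where
  "koebe_prod w p t = (\<Prod>k. 1 - t * koebe (w * p ^ k))"

text \<open>Factor by factor, (1 - u y) (1 - u / y) = (1 - u)^2 - t u, and dividing by (1 - u)^2
  brings in the Koebe function.\<close>

lemma qpoch_inf_mult_divide:
  assumes p: "norm p < 1" and w: "norm w < 1" and y: "y \<noteq> 0"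
  shows "qpoch_inf (w * y) p * qpoch_inf (w / y) p = (qpoch_inf w p)^2 * koebe_prod w p ((1 - y)^2 / y)"
proof (rule LIMSEQ_unique)
  define t where "t = (1 - y)^2 / y"
  show "(\<lambda>n. qpoch (w * y) p n * qpoch (w / y) p n) \<longlonglongrightarrow> qpoch_inf (w * y) p * qpoch_inf (w / y) p"
    by (intro tendsto_intros qpoch_tendsto p)
  have "summable (\<lambda>k. norm (t * koebe (w * p ^ k)))"
    unfolding norm_mult by (intro summable_mult koebe_summable p w)
  hence "(\<lambda>n. \<Prod>k<n. 1 - t * koebe (w * p ^ k)) \<longlonglongrightarrow> koebe_prod w p t"
    unfolding koebe_prod_def by (rule prod_one_minus_tendsto)
  hence "(\<lambda>n. (qpoch w p n)^2 * (\<Prod>k<n. 1 - t * koebe (w * p ^ k))) \<longlonglongrightarrow> (qpoch_inf w p)^2 * koebe_prod w p t"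
    by (intro tendsto_intros qpoch_tendsto p)
  moreover have "(qpoch w p n)^2 * (\<Prod>k<n. 1 - t * koebe (w * p ^ k)) = qpoch (w * y) p n * qpoch (w / y) p n" for n
    unfolding qpoch_def prod.distrib[symmetric] power2_eq_square
  proof (intro prod.cong refl)
    fix k
    define u where "u = w * p ^ k"
    have "1 - u \<noteq> 0" using norm_mult_power_less_1[OF p w, of k] unfolding u_def by auto
    hence "(1 - u) * (1 - u) * (1 - t * koebe u) = (1 - u)^2 - t * u"
      by (simp add: koebe_def power2_eq_square right_diff_distrib)
    also have "\<dots> = (1 - u * y) * (1 - u / y)"
      using y by (simp add: t_def field_simps power2_eq_square)
    finally show "(1 - w * p ^ k) * (1 - w * p ^ k) * (1 - t * koebe (w * p ^ k)) = (1 - w * y * p ^ k) * (1 - w / y * p ^ k)"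
      by (simp add: u_def mult_ac)
  qed
  ultimately show "(\<lambda>n. qpoch (w * y) p n * qpoch (w / y) p n) \<longlonglongrightarrow> (qpoch_inf w p)^2 * koebe_prod w p ((1 - y)^2 / y)"
    by (simp add: t_def)
qed

text \<open>The parameter \<open>t\<close> takes every complex value: \<open>y\<close> solves y^2 -
  (2 + t) y + 1 = 0, whose roots have product 1 and so are nonzero.\<close>

lemma ex_root_parameter:
  fixes t :: complex
  obtains y where "y \<noteq> 0" "(1 - y)^2 / y = t"
proof -
  define s where "s = csqrt (t^2 + 4 * t)"
  define y where "y = (2 + t + s) / 2"
  have s: "s^2 = t^2 + 4 * t" by (simp add: s_def)
  have "y * ((2 + t - s) / 2) = ((2 + t)^2 - s^2) / 4" by (simp add: y_def field_simps power2_eq_square)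
  also have "\<dots> = 1" unfolding s by (simp add: power2_eq_square algebra_simps)
  finally have y: "y \<noteq> 0" by auto
  have "(1 - y)^2 = t * y + (s^2 - (t^2 + 4 * t)) / 4"
    by (simp add: y_def field_simps power2_eq_square)
  hence "(1 - y)^2 = t * y" by (simp add: s)
  with y show ?thesis by (intro that[of y]) auto
qed

text \<open>The factors of the theta quotient depend on \<open>y\<close> only through \<open>t = (1 - y)\<^sup>2 / y\<close>, so
  the three-term relation becomes an identity in \<open>t\<close>, whose linear term at \<open>t = 0\<close> is the
  addition formula for the Weierstrass function.\<close>

theorem lambert_theta_quotient:
  assumes q: "norm q < 1" and x: "norm x = 1"
  shows "(2 * (\<Sum>k. koebe (q * (q^2) ^ k)) - (\<Sum>k. koebe (q * x * (q^2) ^ k)) - (\<Sum>k. koebe (q / x * (q^2) ^ k)))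
      * ((theta_odd q x)^2 * (theta_odd q 1)^2)
    = - q * ((1 - x)^2 / x) * (theta_even q x)^2 * (qpoch_inf (q^2) (q^2)) ^ 4"
proof -
  define p where "p = q^2"
  have p: "norm p < 1" using q by (auto simp: p_def norm_power power_less_one_iff)
  have x0: "x \<noteq> 0" using x by auto
  have w: "norm q < 1" "norm (q * x) < 1" "norm (q / x) < 1"
    using q x by (auto simp: norm_mult norm_divide)
  define K where "K = (theta_odd q x)^2 * (theta_odd q 1)^2"
  define L where "L = q * ((1 - x)^2 / x) * (theta_even q x)^2 * (qpoch_inf p p) ^ 4"
  \<comment> \<open>Holding for every \<open>t\<close>, the relation can be differentiated at 0.
    There each \<open>koebe_prod\<close> equals 1 and has minus a Koebe series as its
    derivative.\<close>
  have eq: "K * (koebe_prod (q * x) p t * koebe_prod (q / x) p t) = K * (koebe_prod q p t * koebe_prod q p t) - L * t * (koebe_prod p p t * koebe_prod p p t)" for t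
  proof -
    obtain y where y: "y \<noteq> 0" "(1 - y)^2 / y = t" by (rule ex_root_parameter)
    note m = qpoch_inf_mult_divide[OF p _ y(1), unfolded y(2)]
    have "theta_odd q (x * y) * theta_odd q (x / y) = (theta_odd q x)^2 * (koebe_prod (q * x) p t * koebe_prod (q / x) p t)"
      using m[OF w(2)] m[OF w(3)] by (simp add: theta_odd_def p_def power2_eq_square mult_ac)
    moreover have "theta_odd q y = theta_odd q 1 * koebe_prod q p t"
      using m[OF w(1)] by (simp add: theta_odd_def p_def power2_eq_square)
    moreover have "theta_even q y = (qpoch_inf p p)^2 * koebe_prod p p t"
      using m[OF p] by (simp add: theta_even_def p_def)
    ultimately show ?thesis
      using theta_three_term[OF q x0 y(1)] unfolding y(2) K_def L_def
      by (simp add: power_mult_distrib algebra_simps power2_eq_square eval_nat_numeral)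
  qed
  have D: "(koebe_prod w p has_field_derivative - (\<Sum>k. koebe (w * p ^ k))) (at 0)" if "norm w < 1" for w
    unfolding koebe_prod_def by (rule prodinf_has_derivative_0[OF koebe_summable[OF p that]])
  have h0: "koebe_prod w p 0 = 1" for w by (simp add: koebe_prod_def)
  define a b c where "a = (\<Sum>k. koebe (q * p ^ k))" and "b = (\<Sum>k. koebe (q * x * p ^ k))" and "c = (\<Sum>k. koebe (q / x * p ^ k))"
  have 1: "((\<lambda>t. K * (koebe_prod (q * x) p t * koebe_prod (q / x) p t)) has_field_derivative K * (- b - c)) (at 0)"
    by (rule derivative_eq_intros D w refl | simp add: h0 b_def c_def)+
  have 2: "((\<lambda>t. K * (koebe_prod q p t * koebe_prod q p t) - L * t * (koebe_prod p p t * koebe_prod p p t)) has_field_derivative K * (- a - a) - L) (at 0)"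
    by (rule derivative_eq_intros D w p refl | simp add: h0 a_def)+
  have "K * (- b - c) = K * (- a - a) - L"
    by (rule DERIV_unique[OF 1 2[folded eq]])
  thus ?thesis unfolding K_def[symmetric] p_def[symmetric] a_def[symmetric] b_def[symmetric] c_def[symmetric]
    by (simp add: L_def algebra_simps)
qed

section \<open>Lambert series as sums of Koebe values\<close>

lemma koebe_sums:
  assumes "norm x < 1"
  shows "(\<lambda>n. of_nat (Suc n) * x ^ Suc n) sums koebe x"
proof -
  have "(\<lambda>n. of_nat (Suc n) * x ^ n) sums (1 / (1 - x)^2)"
    using geometric_deriv_sums[OF assms] .
  from sums_mult[OF this, of x] show ?thesis by (simp add: koebe_def algebra_simps)
qed

text \<open>Both sides sum the family (n + 1) (z q^(2 k + 1))^(n + 1): summing over \<open>k\<close>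
  first gives a geometric series, over \<open>n\<close> first the Koebe function.\<close>

lemma lambert_odd_swap:
  assumes q: "norm q < 1" and z: "norm z \<le> 1"
  shows "(\<lambda>n. of_nat (Suc n) * z ^ Suc n * q ^ Suc n / (1 - q ^ (2 * Suc n)))
    sums (\<Sum>k. koebe (q * z * (q^2) ^ k))"
proof -
  define f where "f = (\<lambda>(n, k). of_nat (Suc n) * (q * z * (q^2) ^ k) ^ Suc n)"
  have p: "norm (q^2) < 1" using q by (simp add: norm_power power_less_one_iff)
  define r where "r = norm q"
  have r: "0 \<le> r" "r < 1" using q by (auto simp: r_def)
  have row: "((\<lambda>k. f (n, k)) has_sum (of_nat (Suc n) * z ^ Suc n * q ^ Suc n / (1 - q ^ (2 * Suc n)))) UNIV" for n
  proof -
    have n1: "norm (q ^ (2 * Suc n)) < 1" using q unfolding norm_power by (subst power_less_one_iff) auto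
    have "f (n, k) = (of_nat (Suc n) * z ^ Suc n * q ^ Suc n) * (q ^ (2 * Suc n)) ^ k" for k
    proof -
      have "((q^2) ^ k) ^ Suc n = (q ^ (2 * Suc n)) ^ k" unfolding power_mult[symmetric] by (simp add: mult_ac)
      thus ?thesis by (simp only: f_def case_prod_conv power_mult_distrib mult_ac)
    qed
    moreover have "((\<lambda>k. (q ^ (2 * Suc n)) ^ k) has_sum (1 / (1 - q ^ (2 * Suc n)))) UNIV"
      using n1 by (intro norm_summable_imp_has_sum geometric_sums) (simp_all add: norm_power summable_geometric)
    ultimately show ?thesis using has_sum_cmult_right by fastforce
  qed
  have wk: "norm (q * z * (q^2) ^ k) \<le> r ^ Suc k" for k
  proof -
    have "norm (q * z * (q^2) ^ k) = norm z * r ^ Suc (2 * k)" by (simp add: r_def norm_mult norm_power power_mult)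
    also have "\<dots> \<le> 1 * r ^ Suc k" using r z by (intro mult_mono power_decreasing) auto
    finally show ?thesis by simp
  qed
  have wk1: "norm (q * z * (q^2) ^ k) < 1" for k
    using wk[of k] r power_le_one[of r k] mult_left_le[of "r ^ k" r] by simp
  have colabs: "summable (\<lambda>n. norm (of_nat (Suc n) * x ^ Suc n))" if "norm x < 1" for x :: complex
  proof -
    have "(\<lambda>n. of_nat (Suc n) * (of_real (norm x) :: complex) ^ Suc n) sums koebe (of_real (norm x))"
      by (rule koebe_sums) (use that in simp)
    hence "summable (\<lambda>n. Re (of_nat (Suc n) * (of_real (norm x) :: complex) ^ Suc n))"
      by (intro summable_Re) (simp add: sums_iff)
    moreover have "Re (of_nat (Suc n) * (of_real (norm x) :: complex) ^ Suc n) = norm (of_nat (Suc n) * x ^ Suc n)" for n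
    proof -
      have "of_nat (Suc n) * (of_real (norm x) :: complex) ^ Suc n = of_real (real (Suc n) * norm x ^ Suc n)" by simp
      thus ?thesis unfolding norm_mult norm_power norm_of_nat by (simp only: Re_complex_of_real)
    qed
    ultimately show ?thesis by simp
  qed
  have col: "((\<lambda>n. f (n, k)) has_sum koebe (q * z * (q^2) ^ k)) UNIV" for k
    using norm_summable_imp_has_sum[OF colabs[OF wk1] koebe_sums[OF wk1]] by (simp only: f_def case_prod_conv)
  have summ: "f summable_on UNIV \<times> UNIV"
  proof (rule abs_summable_summable, rule summable_on_comparison_test)
    have s1: "summable (\<lambda>n. real (Suc n) * r ^ n)"
      using geometric_deriv_sums[of r] r by (auto simp: sums_iff)
    have s2: "summable (\<lambda>k. r ^ Suc k)" using r by (simp add: summable_mult summable_geometric)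
    show "(\<lambda>(n, k). real (Suc n) * r ^ n * r ^ Suc k) summable_on (SIGMA n:UNIV. UNIV)"
    proof (rule summable_on_SigmaI)
      have "((\<lambda>k. r ^ Suc k) has_sum (\<Sum>k. r ^ Suc k)) UNIV"
        using s2 r by (intro norm_summable_imp_has_sum summable_sums) auto
      from has_sum_cmult_right[OF this] show "((\<lambda>k. case (n, k) of (n, k) \<Rightarrow> real (Suc n) * r ^ n * r ^ Suc k)
          has_sum (real (Suc n) * r ^ n * (\<Sum>k. r ^ Suc k))) UNIV" for n by simp
      have "(\<lambda>n. real (Suc n) * r ^ n) summable_on UNIV"
        using s1 r by (intro norm_summable_imp_summable_on) (simp del: of_nat_Suc)
      thus "(\<lambda>n. real (Suc n) * r ^ n * (\<Sum>k. r ^ Suc k)) summable_on UNIV"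
        by (rule summable_on_cmult_left)
    qed (use r in auto)
  next
    fix nk :: "nat \<times> nat"
    obtain n k where nk: "nk = (n, k)" by (cases nk)
    have "norm (f nk) = real (Suc n) * norm (q * z * (q^2) ^ k) ^ Suc n"
      unfolding nk f_def case_prod_conv norm_mult[of "of_nat _"] norm_power norm_of_nat ..
    also have "\<dots> \<le> real (Suc n) * (r ^ Suc k) ^ Suc n"
      using wk by (intro mult_left_mono power_mono) auto
    also have "(r ^ Suc k) ^ Suc n = r ^ (Suc k * Suc n)" by (simp only: power_mult)
    \<comment> \<open>Since (k + 1) (n + 1) is at least n + k + 1, the majorant separates into a
      factor in \<open>n\<close> and one in \<open>k\<close>.\<close>
    also have "\<dots> \<le> r ^ (n + Suc k)" using r by (intro power_decreasing) auto
    finally show "norm (f nk) \<le> (case nk of (n, k) \<Rightarrow> real (Suc n) * r ^ n * r ^ Suc k)"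
      by (simp add: nk power_add mult_ac)
  qed auto
  have total: "(f has_sum infsum f (UNIV \<times> UNIV)) (UNIV \<times> UNIV)"
    by (rule has_sum_infsum[OF summ])
  have A: "((\<lambda>n. of_nat (Suc n) * z ^ Suc n * q ^ Suc n / (1 - q ^ (2 * Suc n))) has_sum infsum f (UNIV \<times> UNIV)) UNIV"
    by (rule has_sum_SigmaD[OF total row])
  have "((\<lambda>k. koebe (q * z * (q^2) ^ k)) has_sum infsum f (UNIV \<times> UNIV)) UNIV"
    by (rule has_sum_SigmaD[OF total[unfolded has_sum_swap[of f]]]) (simp add: col)
  hence "infsum f (UNIV \<times> UNIV) = (\<Sum>k. koebe (q * z * (q^2) ^ k))"
    using has_sum_imp_sums sums_unique by blast
  with has_sum_imp_sums[OF A] show ?thesis by simp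
qed

text \<open>The exponents of \<open>q\<close> are split into the odd 2 k + 1 and the even 2 k +
  2.\<close>

lemma koebe_suminf_parity:
  assumes q: "norm q < 1" and z: "norm z \<le> 1"
  shows "(\<Sum>k. koebe (z * q ^ Suc k)) = (\<Sum>k. koebe (q * z * (q^2) ^ k)) + (\<Sum>k. koebe (z * (q^2) ^ Suc k))"
proof (rule LIMSEQ_unique)
  have p: "norm (q^2) < 1" using q by (simp add: norm_power power_less_one_iff)
  have qz: "norm (q * z) < 1" using norm_mult_power_Suc_less_1[OF q z, of 0] by (simp add: mult_ac)
  have "(\<lambda>n. \<Sum>k<n. koebe (z * q ^ Suc k)) \<longlonglongrightarrow> (\<Sum>k. koebe (z * q ^ Suc k))"
    by (intro summable_LIMSEQ summable_norm_cancel[OF koebe_summable_Suc] q z)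
  thus "(\<lambda>n. \<Sum>k<2*n. koebe (z * q ^ Suc k)) \<longlonglongrightarrow> (\<Sum>k. koebe (z * q ^ Suc k))"
    by (rule filterlim_compose) (rule mult_nat_left_at_top, simp)
  have "(\<Sum>k<2*n. koebe (z * q ^ Suc k)) = (\<Sum>k<n. koebe (q * z * (q^2) ^ k)) + (\<Sum>k<n. koebe (z * (q^2) ^ Suc k))" for n
    by (induction n) (simp_all add: mult_ac power2_eq_square power_mult_distrib power_mult)
  moreover have "(\<lambda>n. (\<Sum>k<n. koebe (q * z * (q^2) ^ k)) + (\<Sum>k<n. koebe (z * (q^2) ^ Suc k)))
      \<longlonglongrightarrow> (\<Sum>k. koebe (q * z * (q^2) ^ k)) + (\<Sum>k. koebe (z * (q^2) ^ Suc k))"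
    by (intro tendsto_add summable_LIMSEQ summable_norm_cancel[OF koebe_summable] summable_norm_cancel[OF koebe_summable_Suc] p qz z)
  ultimately show "(\<lambda>n. \<Sum>k<2*n. koebe (z * q ^ Suc k)) \<longlonglongrightarrow> (\<Sum>k. koebe (q * z * (q^2) ^ k)) + (\<Sum>k. koebe (z * (q^2) ^ Suc k))"
    by simp
qed

text \<open>The even parts of the two evaluations cancel, because squaring swaps the primitive cube
  roots of unity.\<close>

lemma wz_sum_cube_roots:
  assumes q: "norm q < 1"
  shows "(\<Sum>m. wz_term q omega m) + (\<Sum>m. wz_term q (omega^2) m)
    = 2 * (\<Sum>k. koebe (q * (q^2) ^ k)) - (\<Sum>k. koebe (q * omega * (q^2) ^ k)) - (\<Sum>k. koebe (q * omega^2 * (q^2) ^ k))"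
proof -
  have n: "norm omega \<le> 1" "norm (omega^2) \<le> 1" by (simp_all add: norm_power)
  have n1: "norm (1 :: complex) \<le> 1" by simp
  show ?thesis
    using wz_sum_eval[OF q n(1)] wz_sum_eval[OF q n(2)] koebe_suminf_parity[OF q n(1)]
      koebe_suminf_parity[OF q n(2)] koebe_suminf_parity[OF q n1]
    unfolding omega_pow_4 mult_1_right mult_1 by algebra
qed

text \<open>\<omega>^n + \<omega>^(2 n) is 2 when 3 divides n and -1 otherwise, so the character
  becomes a combination of geometric weights.\<close>

lemma chi0_eq: "3 * chi0 n = 2 - omega ^ n - (omega^2) ^ n"
proof -
  have "omega ^ n = omega ^ (3 * (n div 3) + n mod 3)" by simp
  hence w: "omega ^ n = omega ^ (n mod 3)" unfolding power_add power_mult omega_cube by simp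
  have w2: "(omega^2) ^ n = (omega ^ (n mod 3))^2" by (simp add: mult.commute flip: power_mult w)
  consider "n mod 3 = 0" | "n mod 3 = 1" | "n mod 3 = 2" by linarith
  thus ?thesis
  proof cases
    case 1
    thus ?thesis unfolding w w2 chi0_def by (simp add: dvd_eq_mod_eq_0)
  next
    case 2
    thus ?thesis unfolding w w2 chi0_def by (simp add: dvd_eq_mod_eq_0 omega_sq)
  next
    case 3
    hence "\<not> 3 dvd n" by presburger
    moreover have "2 - omega^2 - omega = 3" by (simp add: omega_sq)
    ultimately show ?thesis unfolding w w2 3 omega_pow_4 chi0_def by (simp only: if_False mult_1_right)
  qed
qed

text \<open>In the product formula the two denominators at \<open>s\<close> and \<open>- s\<close>
  combine into one in \<open>s^2 = q\<close>, so the result does not depend on the root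
  chosen.\<close>

lemma psi_mult_uminus:
  assumes s: "norm s < 1" "s^2 = q"
  shows "psi s * psi (- s) = qpoch_inf q (q^2) * (qpoch_inf (q^2) (q^2))^2"
proof -
  have q: "norm q < 1" using s by (auto simp: norm_power power_less_one_iff)
  have q2: "norm (q^2) < 1" using q by (simp add: norm_power power_less_one_iff)
  have nz: "qpoch_inf q (q^2) \<noteq> 0" by (rule qpoch_inf_nonzero[OF q2 q])
  have "psi s * psi (- s) = (qpoch_inf q q)^2 / (qpoch_inf s q * qpoch_inf (- s) q)"
    using psi_product[of s] psi_product[of "- s"] s by (simp add: power2_eq_square)
  also have "qpoch_inf s q * qpoch_inf (- s) q = qpoch_inf q (q^2)"
    using qpoch_inf_mult_uminus[OF q, of s] s by simp
  also have "qpoch_inf q q = qpoch_inf q (q^2) * qpoch_inf (q^2) (q^2)"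
    using qpoch_inf_split_parity[OF q, of q] by (simp add: power2_eq_square)
  finally show ?thesis using nz by (simp add: power2_eq_square)
qed

lemma divide_omega: "x / omega = omega^2 * x" "x / omega^2 = omega * x"
  using omega_cube by (simp_all add: field_simps power2_eq_square power3_eq_cube)

text \<open>All values of \<open>psi\<close> that occur are expressed by the four products
  \<open>E\<close>, \<open>d\<close>, \<open>W\<close>, \<open>V\<close>. The three-term relation at
  \<open>x = y = omega\<close> collapses the difference to a single theta quotient, which the
  Lambert evaluation identifies with \<open>3 * f\<close>.\<close>

theorem psi_quotient_lambert:
  assumes q: "norm q < 1" and r: "r^2 = q"
  shows "psi q ^ 6 / psi (q ^ 3) ^ 2 - psi r ^ 3 * psi (- r) ^ 3 / (psi (r ^ 3) * psi (- (r ^ 3)))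
    = 3 * (2 * (\<Sum>k. koebe (q * (q^2) ^ k)) - (\<Sum>k. koebe (q * omega * (q^2) ^ k)) - (\<Sum>k. koebe (q * omega^2 * (q^2) ^ k)))"
proof -
  define p where "p = q^2"
  define E where "E = qpoch_inf p p"
  define d where "d = qpoch_inf q p"
  define W where "W = theta_odd q omega"
  define V where "V = theta_even q omega"
  have p: "norm p < 1" and q3: "norm (q^3) < 1" "norm ((q^3)^2) < 1"
    using q by (auto simp: p_def norm_power power_less_one_iff)
  have r1: "norm r < 1" "norm (r^3) < 1" "(r^3)^2 = q^3"
  proof -
    have "norm r ^ 2 < 1" using q r by (simp flip: norm_power)
    thus "norm r < 1" by (simp add: power_less_one_iff)
    thus "norm (r^3) < 1" by (simp add: norm_power power_less_one_iff)
    show "(r^3)^2 = q^3" unfolding r[symmetric] by (simp flip: power_mult)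
  qed
  have W': "W = qpoch_inf (omega * q) p * qpoch_inf (omega^2 * q) p"
    unfolding W_def theta_odd_def p_def divide_omega by (simp add: mult.commute)
  have V': "V = qpoch_inf (omega * p) p * qpoch_inf (omega^2 * p) p"
    unfolding V_def theta_even_def p_def divide_omega by (simp add: mult.commute)
  have nz: "E \<noteq> 0" "d \<noteq> 0" "W \<noteq> 0" "V \<noteq> 0"
    unfolding E_def d_def W' V' using p q by (auto simp: qpoch_inf_nonzero norm_mult norm_power)
  have pp: "(q^3)^2 = p^3" by (simp add: p_def flip: power_mult)
  have d3: "qpoch_inf (q^3) ((q^3)^2) = d * W"
    using qpoch_inf_cube[OF p, of q] unfolding pp W' d_def by (simp add: mult_ac)
  have E3: "qpoch_inf ((q^3)^2) ((q^3)^2) = E * V"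
    using qpoch_inf_cube[OF p, of p] unfolding pp V' E_def by (simp add: mult_ac)
  have psi1: "psi q = E / d" using psi_product[OF q] by (simp add: E_def d_def p_def)
  have psi3: "psi (q^3) = E * V / (d * W)" using psi_product[OF q3(1)] unfolding d3 E3 .
  have psir: "psi r * psi (- r) = d * E^2"
    using psi_mult_uminus[OF r1(1) r] by (simp add: d_def E_def p_def)
  have psir3: "psi (r^3) * psi (- (r^3)) = (d * W) * (E * V)^2"
    using psi_mult_uminus[OF r1(2,3)] unfolding d3 E3 .
  have o1: "(1 - omega)^2 / omega = - 3"
  proof -
    have "(1 - omega)^2 = 1 - 2 * omega + omega^2" by (simp add: power2_eq_square algebra_simps)
    also have "\<dots> = - 3 * omega" unfolding omega_sq by simp
    finally show ?thesis by simp
  qed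
  have W1: "theta_odd q 1 = d^2"
    by (simp add: theta_odd_def d_def p_def power2_eq_square)
  \<comment> \<open>\<open>theta_odd\<close> is invariant under inversion of its argument, and
    \<open>omega^2\<close> is the inverse of \<open>omega\<close>.\<close>
  have W2: "theta_odd q (omega * omega) = W"
    unfolding W_def theta_odd_def power2_eq_square[symmetric] divide_omega
    by (simp add: mult.commute)
  \<comment> \<open>The coefficient 9 is the square of (1 - \<omega>)^2 / \<omega> = -3, which
    enters once for each of the two arguments.\<close>
  have dup: "W * d^6 = W^4 - 9 * q * V^4"
  proof -
    have "W * d^2 * (d^2)^2 = W^2 * W^2 - q * (- 3) * (- 3) * V^2 * V^2"
      using theta_three_term[OF q omega_nonzero omega_nonzero]
      unfolding o1 W2 W_def[symmetric] V_def[symmetric] divide_self[OF omega_nonzero] W1 .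
    thus ?thesis by (simp add: eval_nat_numeral mult_ac)
  qed
  define f where "f = 2 * (\<Sum>k. koebe (q * p ^ k)) - (\<Sum>k. koebe (q * omega * p ^ k)) - (\<Sum>k. koebe (q * omega^2 * p ^ k))"
  have "f * (W^2 * (d^2)^2) = - q * (- 3) * V^2 * E^4"
    using lambert_theta_quotient[OF q norm_omega, unfolded o1]
    unfolding W1 W_def[symmetric] V_def[symmetric] p_def[symmetric] E_def[symmetric] divide_omega
      mult.commute[of "omega^2" q] f_def .
  hence f: "3 * f = 9 * q * V^2 * E^4 / (W^2 * d^4)" using nz by (simp add: field_simps flip: power_mult)
  have "psi q ^ 6 / psi (q ^ 3) ^ 2 - psi r ^ 3 * psi (- r) ^ 3 / (psi (r ^ 3) * psi (- (r ^ 3)))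
      = (E / d)^6 / (E * V / (d * W))^2 - (d * E^2)^3 / ((d * W) * (E * V)^2)"
    unfolding power_mult_distrib[of "psi r", symmetric] psir psir3 psi1 psi3 ..
  also have "\<dots> = E^4 * (W^4 - W * d^6) / (V^2 * d^4 * W^2)"
    using nz by (simp add: divide_simps) (simp add: algebra_simps eval_nat_numeral)
  also have "\<dots> = 9 * q * V^2 * E^4 / (W^2 * d^4)"
    unfolding dup using nz by (simp add: divide_simps)
  finally show ?thesis unfolding f[symmetric] f_def p_def .
qed

text \<open>Combines the Lambert expansions at the three cube roots of unity with weights 2, -1,
  -1.\<close>

lemma chi0_lambert_sums:
  assumes q: "norm q < 1"
  shows "(\<lambda>n. chi0 (Suc n) * (of_nat (Suc n) * q ^ Suc n / (1 - q ^ (2 * Suc n)))) sums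
    ((2 * (\<Sum>k. koebe (q * (q^2) ^ k)) - (\<Sum>k. koebe (q * omega * (q^2) ^ k)) - (\<Sum>k. koebe (q * omega^2 * (q^2) ^ k))) / 3)"
proof -
  define l where "l n = of_nat (Suc n) * q ^ Suc n / (1 - q ^ (2 * Suc n))" for n
  have l: "(\<lambda>n. z ^ Suc n * l n) sums (\<Sum>k. koebe (q * z * (q^2) ^ k))" if "norm z \<le> 1" for z
    using lambert_odd_swap[OF q that] by (simp only: l_def times_divide_eq_right mult_ac)
  have n: "norm omega \<le> 1" "norm (omega^2) \<le> 1" by (simp_all add: norm_power)
  have "(\<lambda>n. 2 * (1 ^ Suc n * l n) - omega ^ Suc n * l n - (omega^2) ^ Suc n * l n) sums
    (2 * (\<Sum>k. koebe (q * 1 * (q^2) ^ k)) - (\<Sum>k. koebe (q * omega * (q^2) ^ k)) - (\<Sum>k. koebe (q * omega^2 * (q^2) ^ k)))"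
    by (intro sums_diff sums_mult l n) simp
  moreover have "2 * (1 ^ Suc n * l n) - omega ^ Suc n * l n - (omega^2) ^ Suc n * l n = 3 * (chi0 (Suc n) * l n)" for n
    unfolding mult.assoc[symmetric, of 3] chi0_eq by (simp add: algebra_simps)
  ultimately have "(\<lambda>n. 3 * (chi0 (Suc n) * l n)) sums
    (2 * (\<Sum>k. koebe (q * (q^2) ^ k)) - (\<Sum>k. koebe (q * omega * (q^2) ^ k)) - (\<Sum>k. koebe (q * omega^2 * (q^2) ^ k)))"
    by simp
  from sums_divide[OF this, of 3] show ?thesis unfolding l_def[symmetric] by simp
qed

text \<open>At a primitive cube root of unity \<open>1 / a = a\<^sup>2\<close>, so the product of the \<open>q\<^sup>i - a\<close> cancels
  against \<open>(a\<^sup>2 q; q)\<^sub>n\<close> up to one factor.\<close>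

lemma wz_term_cube_root:
  assumes q: "norm q < 1" and a: "1 + a + a^2 = 0"
  shows "wz_term q a n = (1 - a^2) *
     ((1 - a * q ^ (2 * Suc n)) * qpoch q q (Suc n - 1) * qpoch (a^2 * q) (q^2) (Suc n) * (- (a * q)) ^ Suc n
        / ((1 - q ^ (3 * Suc n)) * qpoch (a * q) q (Suc n) * qpoch q (q^2) (Suc n)))"
proof -
  have "(1 - a) * (1 + a + a^2) = 1 - a^3" by (simp add: algebra_simps power2_eq_square power3_eq_cube)
  hence a3: "a^3 = 1" using a by simp
  have na: "norm a = 1"
  proof -
    have "norm a ^ 3 = 1" using a3 by (simp flip: norm_power)
    thus ?thesis using power_eq_iff_eq_base[of 3 "norm a" 1] by simp
  qed
  have a2: "norm (a^2) = 1" by (simp add: norm_power na)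
  define x where "x = q ^ Suc n"
  have nz: "1 - a^2 * x \<noteq> 0"
    unfolding x_def by (rule one_minus_mult_power_nonzero[OF q]) (simp add: a2)
  have aq: "norm (a^2 * q) < 1" using q by (simp add: norm_mult a2)
  define A where "A = qpoch (a^2 * q) q n"
  have A: "A \<noteq> 0" unfolding A_def by (rule qpoch_nonzero[OF q aq])
  have P: "(\<Prod>i<Suc n. q ^ i - a) = (- a) ^ Suc n * ((1 - a^2) * A)"
  proof -
    have "q ^ i - a = - a * (1 - a^2 * q ^ i)" for i
    proof -
      have "- a * (1 - a^2 * q ^ i) = a^3 * q ^ i - a" by (simp add: algebra_simps power2_eq_square power3_eq_cube)
      thus ?thesis by (simp add: a3)
    qed
    hence "(\<Prod>i<Suc n. q ^ i - a) = (\<Prod>i<Suc n. - a) * qpoch (a^2) q (Suc n)"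
      unfolding qpoch_def prod.distrib[symmetric] by (intro prod.cong refl)
    thus ?thesis unfolding A_def qpoch_Suc_shift by simp
  qed
  have C: "qpoch (a^2 * q) q (Suc n) = A * (1 - a^2 * x)"
    by (simp add: qpoch_Suc A_def x_def mult_ac)
  \<comment> \<open>The three linear factors left in the denominator, one of them the last factor of
    \<open>qpoch (a^2 * q) q (Suc n)\<close>, merge into \<open>1 - q ^ (3 * Suc n)\<close>.\<close>
  have "1 - x^3 = (1 - x) * (1 - a * x) * (1 - a^2 * x)"
  proof -
    have "(1 - x) * (1 - a * x) * (1 - a^2 * x)
        = 1 - x * (1 + a + a^2) + a * x^2 * (1 + a + a^2) - a^3 * x^3"
      by (simp add: algebra_simps power2_eq_square power3_eq_cube)
    thus ?thesis by (simp add: a a3)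
  qed
  hence x3: "1 - q ^ (3 * Suc n) = (1 - x) * (1 - a * x) * (1 - a^2 * x)"
    unfolding x_def by (simp only: power_mult[symmetric] mult.commute)
  have aq: "(- (a * q)) ^ Suc n = (- a) ^ Suc n * x"
    unfolding x_def by (simp only: power_mult_distrib[symmetric] mult_minus_left)
  define B where "B = qpoch (a * q) q (Suc n)"
  define D where "D = qpoch q (q^2) (Suc n)"
  define S where "S = (1 - a * q ^ (2 * Suc n)) * qpoch q q n"
  define T where "T = qpoch (a^2 * q) (q^2) (Suc n)"
  show ?thesis
    unfolding wz_term_def P C x3 aq diff_Suc_1 x_def[symmetric] B_def[symmetric] D_def[symmetric] S_def[symmetric] T_def[symmetric]
    using A nz by (simp add: divide_simps)
qed

text \<open>Sums from 1 are indexed by \<open>Suc n\<close>. Summability is part of the conclusion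
  because \<open>suminf\<close> of a divergent series is an unspecified value.\<close>

theorem corollary8:
  fixes q r :: complex
  assumes "norm q < 1" and "r ^ 2 = q"
  shows
    "let a = (\<lambda>n::nat. chi0 n * (of_nat n * q ^ n / (1 - q ^ (2 * n))));
         b = (\<lambda>n::nat.
               (1 - omega * q ^ (2 * n)) * qpoch q q (n - 1) * qpoch (omega ^ 2 * q) (q ^ 2) n
                 * (- (omega * q)) ^ n
               / ((1 - q ^ (3 * n)) * qpoch (omega * q) q n * qpoch q (q ^ 2) n));
         c = (\<lambda>n::nat.
               (1 - omega ^ 2 * q ^ (2 * n)) * qpoch q q (n - 1) * qpoch (omega * q) (q ^ 2) n
                 * (- (omega ^ 2 * q)) ^ n
               / ((1 - q ^ (3 * n)) * qpoch (omega ^ 2 * q) q n * qpoch q (q ^ 2) n))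
     in psi q = qpoch_inf (q ^ 2) (q ^ 2) / qpoch_inf q (q ^ 2)
        \<and> summable (\<lambda>n. a (Suc n)) \<and> summable (\<lambda>n. b (Suc n)) \<and> summable (\<lambda>n. c (Suc n))
        \<and> 9 * (\<Sum>n. a (Suc n))
            = psi q ^ 6 / psi (q ^ 3) ^ 2
              - psi r ^ 3 * psi (- r) ^ 3 / (psi (r ^ 3) * psi (- (r ^ 3)))
        \<and> psi q ^ 6 / psi (q ^ 3) ^ 2
              - psi r ^ 3 * psi (- r) ^ 3 / (psi (r ^ 3) * psi (- (r ^ 3)))
            = 3 * (1 - omega ^ 2) * (\<Sum>n. b (Suc n)) + 3 * (1 - omega) * (\<Sum>n. c (Suc n))"
proof -
  note q = assms(1)
  define a b c where "a = (\<lambda>n::nat. chi0 n * (of_nat n * q ^ n / (1 - q ^ (2 * n))))"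
    and "b = (\<lambda>n::nat.
               (1 - omega * q ^ (2 * n)) * qpoch q q (n - 1) * qpoch (omega ^ 2 * q) (q ^ 2) n
                 * (- (omega * q)) ^ n
               / ((1 - q ^ (3 * n)) * qpoch (omega * q) q n * qpoch q (q ^ 2) n))"
    and "c = (\<lambda>n::nat.
               (1 - omega ^ 2 * q ^ (2 * n)) * qpoch q q (n - 1) * qpoch (omega * q) (q ^ 2) n
                 * (- (omega ^ 2 * q)) ^ n
               / ((1 - q ^ (3 * n)) * qpoch (omega ^ 2 * q) q n * qpoch q (q ^ 2) n))"
  define f where "f = 2 * (\<Sum>k. koebe (q * (q^2) ^ k)) - (\<Sum>k. koebe (q * omega * (q^2) ^ k)) - (\<Sum>k. koebe (q * omega^2 * (q^2) ^ k))"
  have a: "(\<lambda>n. a (Suc n)) sums (f / 3)"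
    using chi0_lambert_sums[OF q] unfolding a_def f_def .
  have neq: "1 - omega \<noteq> 0" "1 - omega^2 \<noteq> 0"
  proof -
    show "1 - omega \<noteq> 0" using omega_neq_1 by simp
    show "1 - omega^2 \<noteq> 0" using omega_pow_4 omega_neq_1 by (metis power_one right_minus_eq)
  qed
  \<comment> \<open>The other primitive root \<open>omega^2\<close> has \<open>omega\<close> as its
    square, which turns the generic summand into the one of \<open>c\<close>.\<close>
  have "1 + omega^2 + (omega^2)^2 = 0" unfolding omega_pow_4 using omega_sum by (simp add: add_ac)
  note t2 = wz_term_cube_root[OF q this, unfolded omega_pow_4]
  have n: "norm omega \<le> 1" "norm (omega^2) \<le> 1" by (simp_all add: norm_power)
  \<comment> \<open>The prefactor \<open>1 - omega^2\<close> of the well poised term is divided out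
    here and reappears as the coefficient of the series.\<close>
  have "b (Suc n) = wz_term q omega n / (1 - omega^2)" for n
    unfolding b_def wz_term_cube_root[OF q omega_sum] by (rule nonzero_mult_div_cancel_left[OF neq(2), symmetric])
  hence b: "(\<lambda>n. b (Suc n)) sums ((\<Sum>n. wz_term q omega n) / (1 - omega^2))"
    by (simp only: sums_divide[OF summable_sums[OF wz_term_summable[OF q n(1)]]])
  have "c (Suc n) = wz_term q (omega^2) n / (1 - omega)" for n
    unfolding c_def t2 by (rule nonzero_mult_div_cancel_left[OF neq(1), symmetric])
  hence c: "(\<lambda>n. c (Suc n)) sums ((\<Sum>n. wz_term q (omega^2) n) / (1 - omega))"
    by (simp only: sums_divide[OF summable_sums[OF wz_term_summable[OF q n(2)]]])
  have cancel: "3 * k * (x / k) = 3 * x" if "k \<noteq> 0" for k x :: complex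
    using that by simp
  have "3 * (1 - omega^2) * (\<Sum>n. b (Suc n)) + 3 * (1 - omega) * (\<Sum>n. c (Suc n))
      = 3 * ((\<Sum>n. wz_term q omega n) + (\<Sum>n. wz_term q (omega^2) n))"
    unfolding sums_unique[OF b, symmetric] sums_unique[OF c, symmetric] cancel[OF neq(1)] cancel[OF neq(2)]
    by (simp only: distrib_left)
  also have "\<dots> = 3 * f" unfolding wz_sum_cube_roots[OF q] f_def ..
  finally have bc: "3 * (1 - omega^2) * (\<Sum>n. b (Suc n)) + 3 * (1 - omega) * (\<Sum>n. c (Suc n)) = 3 * f" .
  have "9 * (\<Sum>n. a (Suc n)) = 3 * f"
    unfolding sums_unique[OF a, symmetric] by simp
  note concl = psi_product[OF q] sums_summable[OF a] sums_summable[OF b] sums_summable[OF c]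
    this[folded psi_quotient_lambert[OF assms, folded f_def]] bc[symmetric, folded psi_quotient_lambert[OF assms, folded f_def]]
  show ?thesis
    unfolding Let_def using concl unfolding a_def b_def c_def by (intro conjI)
qed

end
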